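(* Let $\gamma>1/2$. Let $\{a_n\}_{n\in\mathbb{Z}}$ and $\{b_n\}_{n\in\mathbb{Z}}$ be real sequences such that $\sum_n |b_n|^{\gamma+1/2}<\infty$, $a_n\ge 0$ for all $n\in\mathbb{Z}$, $\lim_{n\to\pm\infty}a_n=1$ and $\sum_n (a_n-1)_+^{\gamma+1/2}<\infty$. Let $J=W(\{a_n\},\{b_n\})$ be the associated symmetric Jacobi matrix on $\ell^2(\mathbb{Z})$, let $E_j^+(J)$ denote its eigenvalues larger than $2$ and $E_j^-(J)$ its eigenvalues less than $-2$. Then, for each of the two choices of sign (the same sign taken throughout), $$ \sum_j\int_2^{|E_j^\pm(J)|}(t^2-4)^{\frac12}\,\big(|E_j^\pm(J)|-t\big)^{\gamma-\frac32}\,dt\le \mathrm{B}(\gamma-1/2,2)\sum_{n\in\mathbb{Z}}\big(\pm[b_n]_\pm\pm[a_n-1]_+\pm[a_{n-1}-1]_+\big)_\pm^{\gamma+\frac12}, $$ where $\mathrm{B}(x,y)$ denotes the Beta function.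
   Context: For real sequences $\{a_n\}_{n\in\mathbb{Z}}$, $\{b_n\}_{n\in\mathbb{Z}}$ (bounded), $W(\{a_n\},\{b_n\})$ denotes the symmetric tridiagonal (Jacobi) matrix with diagonal entries $b_n$ and off-diagonal entries $a_n$, i.e. the bounded self-adjoint operator on $\ell^2(\mathbb{Z})$ given by $(Ju)_n=a_{n-1}u_{n-1}+b_nu_n+a_nu_{n+1}$. Since $a_n\to1$ and $b_n\to0$ as $n\to\pm\infty$, its essential spectrum is $[-2,2]$. Eigenvalues are repeated according to multiplicity. For real $x$, $[x]_\pm=(x)_\pm=\max\{\pm x,0\}$; in particular $[x]_-=\max\{-x,0\}\ge0$. The expression $(x)_\pm^{p}$ means $\big((x)_\pm\big)^p$. *)

theory Defs
  imports "HOL-Analysis.Analysis" "HOL-Library.Function_Algebras" "HOL-Library.Extended_Nat"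
begin

definition pos_part :: "real \<Rightarrow> real" where
  "pos_part x = max x 0"

definition neg_part :: "real \<Rightarrow> real" where
  "neg_part x = max (- x) 0"

definition seq_scale :: "complex \<Rightarrow> (int \<Rightarrow> complex) \<Rightarrow> int \<Rightarrow> complex" where
  "seq_scale c u = (\<lambda>n. c * u n)"

global_interpretation seq: vector_space seq_scale
  defines seq_dim = seq.dim
    and seq_span = seq.span
  by unfold_locales (auto simp: seq_scale_def fun_eq_iff algebra_simps)

definition ell2 :: "(int \<Rightarrow> complex) set" where
  "ell2 = {u. (\<lambda>n. (cmod (u n))\<^sup>2) summable_on UNIV}"

text \<open>The action of the Jacobi matrix \<open>W({a\<^sub>n}, {b\<^sub>n})\<close>, written on all two-sided sequences; it is
  only applied to elements of \<^const>\<open>ell2\<close>, which it preserves when \<open>a\<close> and \<open>b\<close> are bounded.\<close>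

definition jacobi :: "(int \<Rightarrow> real) \<Rightarrow> (int \<Rightarrow> real) \<Rightarrow> (int \<Rightarrow> complex) \<Rightarrow> int \<Rightarrow> complex" where
  "jacobi a b u = (\<lambda>n. of_real (a (n - 1)) * u (n - 1) + of_real (b n) * u n
                        + of_real (a n) * u (n + 1))"

definition eigenspace ::
  "((int \<Rightarrow> complex) \<Rightarrow> int \<Rightarrow> complex) \<Rightarrow> real \<Rightarrow> (int \<Rightarrow> complex) set" where
  "eigenspace T E = {u \<in> ell2. T u = seq_scale (of_real E) u}"

definition is_eigenvalue :: "((int \<Rightarrow> complex) \<Rightarrow> int \<Rightarrow> complex) \<Rightarrow> real \<Rightarrow> bool" where
  "is_eigenvalue T E \<longleftrightarrow> (\<exists>u \<in> eigenspace T E. u \<noteq> 0)"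

text \<open>The case distinction is needed because the library's dimension is \<open>0\<close> on
  infinite-dimensional spaces.\<close>

definition eigen_mult :: "((int \<Rightarrow> complex) \<Rightarrow> int \<Rightarrow> complex) \<Rightarrow> real \<Rightarrow> enat" where
  "eigen_mult T E =
     (if \<exists>B. finite B \<and> eigenspace T E \<subseteq> seq_span B then enat (seq_dim (eigenspace T E)) else \<infinity>)"

text \<open>Eigenvalues repeated according to multiplicity: an eigenvalue \<open>E\<close> of multiplicity \<open>m\<close> occurs
  as the \<open>m\<close> pairs \<open>(E, 0), (E, 1), \<dots>, (E, m - 1)\<close>.\<close>

definition eigenvalues_rep :: "((int \<Rightarrow> complex) \<Rightarrow> int \<Rightarrow> complex) \<Rightarrow> (real \<times> nat) set" where
  "eigenvalues_rep T = {(E, k). is_eigenvalue T E \<and> enat k < eigen_mult T E}"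

end

theory Submission imports Defs begin

text \<open>
  Conjugation by \<open>(-1)\<^sup>n\<close> turns \<open>J\<close> into minus the Jacobi matrix with diagonal \<open>- b\<close>, so only eigenvalues
  above \<open>2\<close> matter. Let \<open>V\<^sub>n = (b\<^sub>n)\<^sub>+ + (a\<^sub>n - 1)\<^sub>+ + (a\<^bsub>n-1\<^esub> - 1)\<^sub>+\<close>. For \<open>s \<ge> 0\<close> one has
  \<open>J - s \<le> J' + W\<close> with \<open>J'\<close> the matrix with zero diagonal and bonds \<open>min a\<^sub>n 1\<close>, and \<open>W = (V - s)\<^sub>+\<close>.
  Integrating against \<open>s\<close> to the power \<open>\<gamma> - 3/2\<close> reduces the theorem to the endpoint bound
  \<open>\<Sum> sqrt (E\<^sub>j\<^sup>2 - 4) \<le> \<Sum> W\<^sub>n\<close> for the eigenvalues \<open>E\<^sub>j > 2\<close> of \<open>J' + W\<close>.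

  For \<open>E > 2\<close> the kernel of \<open>(E - J')\<^sup>-\<^sup>1\<close> at \<open>(i, j)\<close> is \<open>sqrt (d\<^sub>i d\<^sub>j)\<close> times the product, over the
  bonds \<open>l\<close> between \<open>i\<close> and \<open>j\<close>, of numbers \<open>c\<^sub>l(E) \<in> [0, 1]\<close>; here \<open>d\<^sub>i \<le> 1 / sqrt (E\<^sup>2 - 4)\<close> because all
  bonds are at most \<open>1\<close>, and \<open>c\<^sub>l\<close> decreases in \<open>E\<close>. With \<open>C\<^sub>E\<close> the kernel of bond products, the
  Birman-Schwinger principle makes \<open>\<surd>W C\<^sub>E \<surd>W\<close> at \<open>E = E\<^sub>k\<close> at least \<open>sqrt (E\<^sub>k\<^sup>2 - 4)\<close> on a subspace of
  dimension \<open>k\<close>. The supremum of the trace of this form over orthonormal \<open>k\<close>-frames increases in every \<open>c\<^sub>l\<close>,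
  hence as \<open>E\<close> decreases through \<open>E\<^sub>1 \<ge> E\<^sub>2 \<ge> \<dots>\<close>, and each step gains a further \<open>sqrt (E\<^sub>k\<^sup>2 - 4)\<close>. At \<open>c = 1\<close>
  the form has rank one and trace \<open>\<Sum> W\<^sub>n\<close>.
\<close>

section \<open>Bond kernels and orthonormal frames\<close>

definition orthonormal_frame :: "int set \<Rightarrow> (nat \<Rightarrow> int \<Rightarrow> complex) \<Rightarrow> nat \<Rightarrow> bool" where
  "orthonormal_frame I F k \<longleftrightarrow>
     (\<forall>p<k. \<forall>q<k. (\<Sum>i\<in>I. cnj (F p i) * F q i) = (if p = q then 1 else 0))"

text \<open>Bond \<open>l\<close> joins the sites \<open>l\<close> and \<open>l + 1\<close>, so the
  half-open interval lists the bonds between \<open>i\<close> and \<open>j\<close>; on the diagonal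
  the product is empty and equals 1.\<close>

definition bond_prod :: "(int \<Rightarrow> real) \<Rightarrow> int \<Rightarrow> int \<Rightarrow> real" where
  "bond_prod c i j = prod c {min i j..<max i j}"

text \<open>The inner product of complex numbers is the real one, Re (cnj (v i) * v j). As the
  kernel is real and symmetric, this is its full Hermitian quadratic form.\<close>

definition kernel_form ::
  "int set \<Rightarrow> (int \<Rightarrow> real) \<Rightarrow> (int \<Rightarrow> real) \<Rightarrow> (int \<Rightarrow> complex) \<Rightarrow> real" where
  "kernel_form I w c v = (\<Sum>i\<in>I. \<Sum>j\<in>I. w i * w j * bond_prod c i j * (v i \<bullet> v j))"

lemma bond_prod_fun_upd:
  "bond_prod (c(l := x)) i j =
     (if l \<in> {min i j..<max i j} then x * prod c ({min i j..<max i j} - {l}) else bond_prod c i j)"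
proof (cases "l \<in> {min i j..<max i j}")
  case True
  have "prod (c(l := x)) {min i j..<max i j}
      = (c(l := x)) l * prod (c(l := x)) ({min i j..<max i j} - {l})"
    by (rule prod.remove) (use True in auto)
  also have "prod (c(l := x)) ({min i j..<max i j} - {l}) = prod c ({min i j..<max i j} - {l})"
    by (rule prod.cong) auto
  finally show ?thesis using True by (simp add: bond_prod_def)
next
  case False
  have "prod (c(l := x)) {min i j..<max i j} = prod c {min i j..<max i j}"
    by (rule prod.cong) (use False in auto)
  then show ?thesis using False unfolding bond_prod_def by (simp only: if_False)
qed

text \<open>A bond occurs at most once in each product, so every kernel entry has degree at most one
  in its weight.\<close>

lemma kernel_form_affine:
  "kernel_form I w (c(l := x)) v =
     kernel_form I w (c(l := 0)) v
       + x * (kernel_form I w (c(l := 1)) v - kernel_form I w (c(l := 0)) v)"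
proof -
  have *: "bond_prod (c(l := x)) i j =
      bond_prod (c(l := 0)) i j + x * (bond_prod (c(l := 1)) i j - bond_prod (c(l := 0)) i j)"
    for i j by (cases "l \<in> {min i j..<max i j}") (simp_all only: bond_prod_fun_upd if_True if_False, simp_all)
  have "w i * w j * bond_prod (c(l := x)) i j * (v i \<bullet> v j) =
      w i * w j * bond_prod (c(l := 0)) i j * (v i \<bullet> v j)
      + x * (w i * w j * bond_prod (c(l := 1)) i j * (v i \<bullet> v j)
           - w i * w j * bond_prod (c(l := 0)) i j * (v i \<bullet> v j))" for i j
    unfolding *[of i j] by (simp only: algebra_simps)
  then show ?thesis
    unfolding kernel_form_def
    by (simp only: sum.distrib sum_distrib_left[symmetric] sum_subtractf)
qed

definition flip_above :: "int \<Rightarrow> (int \<Rightarrow> complex) \<Rightarrow> int \<Rightarrow> complex" where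
  "flip_above l v i = (if i > l then - v i else v i)"

text \<open>Bond \<open>l\<close> enters the product for \<open>i\<close> and \<open>j\<close>
  exactly when one of the two sites lies beyond it and the other does not, which is exactly when the
  flip changes the sign of \<open>v i \<bullet> v j\<close>.\<close>

lemma kernel_form_flip:
  "kernel_form I w (c(l := x)) (flip_above l v) = kernel_form I w (c(l := - x)) v"
proof -
  have "w i * w j * bond_prod (c(l := x)) i j * (flip_above l v i \<bullet> flip_above l v j)
      = w i * w j * bond_prod (c(l := - x)) i j * (v i \<bullet> v j)" for i j
    unfolding bond_prod_fun_upd flip_above_def
    by (cases i j rule: linorder_cases) (auto simp: min_def max_def)
  then show ?thesis unfolding kernel_form_def by (simp only:)
qed

lemma orthonormal_frame_flip:
  "orthonormal_frame I F k \<Longrightarrow> orthonormal_frame I (\<lambda>p. flip_above l (F p)) k"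
proof -
  have "(\<Sum>i\<in>I. cnj (flip_above l (F p) i) * flip_above l (F q) i) = (\<Sum>i\<in>I. cnj (F p i) * F q i)"
    for p q by (rule sum.cong) (auto simp: flip_above_def)
  then show "orthonormal_frame I F k \<Longrightarrow> ?thesis"
    unfolding orthonormal_frame_def by simp
qed

text \<open>The form is affine in each bond weight \<open>x\<close>, and changing the sign of \<open>x\<close> amounts to flipping
  the sign of all components beyond the bond; so on \<open>[- t, t]\<close> it is maximal at \<open>t\<close>, up to a flip.\<close>

lemma kernel_form_mono_bond:
  assumes "orthonormal_frame I F k" "\<bar>x\<bar> \<le> t"
  shows "\<exists>F'. orthonormal_frame I F' k \<and>
    (\<Sum>p<k. kernel_form I w (c(l := x)) (F p)) \<le> (\<Sum>p<k. kernel_form I w (c(l := t)) (F' p))"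
proof -
  define P where "P = (\<Sum>p<k. kernel_form I w (c(l := 0)) (F p))"
  define R where "R = (\<Sum>p<k. kernel_form I w (c(l := 1)) (F p) - kernel_form I w (c(l := 0)) (F p))"
  have aff: "(\<Sum>p<k. kernel_form I w (c(l := y)) (F p)) = P + y * R" for y
    unfolding P_def R_def sum_distrib_left
    by (subst kernel_form_affine) (simp only: sum.distrib)
  show ?thesis
  proof (cases "R \<ge> 0")
    case True
    then have "x * R \<le> t * R" using assms by (intro mult_right_mono) auto
    then show ?thesis using assms(1) aff by (intro exI[of _ F]) simp
  next
    case False
    then have "x * R \<le> - t * R" using assms by (intro mult_right_mono_neg) auto
    then have "P + x * R \<le> P + - t * R" by linarith
    then show ?thesis
      using orthonormal_frame_flip[OF assms(1), of l] aff
      by (intro exI[of _ "\<lambda>p. flip_above l (F p)"]) (simp only: kernel_form_flip)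
  qed
qed

lemma kernel_form_cong:
  assumes "\<And>i. i \<in> {lo..hi} \<Longrightarrow> c i = c' i"
  shows "kernel_form {lo..hi} w c v = kernel_form {lo..hi} w c' v"
proof -
  have "bond_prod c i j = bond_prod c' i j" if "i \<in> {lo..hi}" "j \<in> {lo..hi}" for i j
    unfolding bond_prod_def by (rule prod.cong) (use that assms in \<open>auto simp: min_def max_def split: if_splits\<close>)
  then show ?thesis unfolding kernel_form_def by (intro sum.cong) auto
qed

text \<open>The bonds are raised one after the other from left to right, each time at the price of a
  new frame. Since the old weights are nonnegative, their absolute values are at most the new
  weights, as a single step demands.\<close>

lemma kernel_form_mono:
  assumes "orthonormal_frame {lo..hi} F k" "\<And>i. 0 \<le> c i" "\<And>i. c i \<le> c' i"
  shows "\<exists>F'. orthonormal_frame {lo..hi} F' k \<and>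
    (\<Sum>p<k. kernel_form {lo..hi} w c (F p)) \<le> (\<Sum>p<k. kernel_form {lo..hi} w c' (F' p))"
proof -
  have "\<exists>F'. orthonormal_frame {lo..hi} F' k \<and> (\<Sum>p<k. kernel_form {lo..hi} w c (F p))
      \<le> (\<Sum>p<k. kernel_form {lo..hi} w (\<lambda>i. if i < lo + int m then c' i else c i) (F' p))" for m
  proof (induction m)
    case 0
    have "kernel_form {lo..hi} w (\<lambda>i. if i < lo then c' i else c i) v = kernel_form {lo..hi} w c v" for v
      by (rule kernel_form_cong) auto
    then show ?case using assms(1) by auto
  next
    case (Suc m)
    define d where "d = (\<lambda>i. if i < lo + int m then c' i else c i)"
    obtain F' where F': "orthonormal_frame {lo..hi} F' k"
      "(\<Sum>p<k. kernel_form {lo..hi} w c (F p)) \<le> (\<Sum>p<k. kernel_form {lo..hi} w d (F' p))"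
      using Suc unfolding d_def by blast
    have "d(lo + int m := d (lo + int m)) = d" by simp
    moreover have "\<bar>d (lo + int m)\<bar> \<le> c' (lo + int m)"
      using assms(2,3)[of "lo + int m"] unfolding d_def by simp
    ultimately obtain F'' where F'': "orthonormal_frame {lo..hi} F'' k"
      "(\<Sum>p<k. kernel_form {lo..hi} w d (F' p))
        \<le> (\<Sum>p<k. kernel_form {lo..hi} w (d(lo + int m := c' (lo + int m))) (F'' p))"
      using kernel_form_mono_bond[OF F'(1)] by metis
    have d': "d(lo + int m := c' (lo + int m)) = (\<lambda>i. if i < lo + int (Suc m) then c' i else c i)"
      unfolding d_def by (auto simp: fun_eq_iff)
    show ?case
      using F''(1) order_trans[OF F'(2) F''(2)] unfolding d' by (intro exI[of _ F'']) (rule conjI)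
  qed
  \<comment> \<open>After one replacement per site of the interval, all bonds that the form sees
    have their new weight.\<close>
  from this[of "nat (hi - lo + 1)"] obtain F' where F': "orthonormal_frame {lo..hi} F' k"
    "(\<Sum>p<k. kernel_form {lo..hi} w c (F p))
      \<le> (\<Sum>p<k. kernel_form {lo..hi} w (\<lambda>i. if i < lo + int (nat (hi - lo + 1)) then c' i else c i) (F' p))"
    by blast
  have "kernel_form {lo..hi} w (\<lambda>i. if i < lo + int (nat (hi - lo + 1)) then c' i else c i) v
      = kernel_form {lo..hi} w c' v" for v
    by (rule kernel_form_cong) auto
  then show ?thesis using F' by auto
qed

lemma bessel_frame:
  assumes "finite I" "orthonormal_frame I F k"
  shows "(\<Sum>p<k. (cmod (\<Sum>i\<in>I. of_real (w i) * F p i))\<^sup>2) \<le> (\<Sum>i\<in>I. (w i)\<^sup>2)"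
proof -
  define t where "t p = (\<Sum>i\<in>I. cnj (F p i) * of_real (w i))" for p
  have t_cnj: "cnj (t p) = (\<Sum>i\<in>I. of_real (w i) * F p i)" for p
    unfolding t_def by (simp add: mult.commute)
  \<comment> \<open>\<open>t\<close> holds the coefficients of \<open>w\<close> in the frame, and
    \<open>z\<close> is the part of \<open>w\<close> orthogonal to the frame. Bessel's inequality is
    the nonnegativity of its square norm.\<close>
  define z where "z i = of_real (w i) - (\<Sum>p<k. t p * F p i)" for i
  have cross: "(\<Sum>i\<in>I. cnj (of_real (w i)) * (\<Sum>p<k. t p * F p i)) = (\<Sum>p<k. t p * cnj (t p))"
    unfolding t_cnj by (simp add: sum_distrib_left mult_ac) (rule sum.swap)
  have cross': "(\<Sum>i\<in>I. cnj (\<Sum>p<k. t p * F p i) * of_real (w i)) = (\<Sum>p<k. t p * cnj (t p))"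
    using arg_cong[OF cross, of cnj] by (simp add: mult.commute)
  have sq: "(\<Sum>i\<in>I. cnj (\<Sum>p<k. t p * F p i) * (\<Sum>q<k. t q * F q i)) = (\<Sum>p<k. t p * cnj (t p))"
  proof -
    have "(\<Sum>i\<in>I. cnj (\<Sum>p<k. t p * F p i) * (\<Sum>q<k. t q * F q i))
       = (\<Sum>i\<in>I. \<Sum>p<k. \<Sum>q<k. cnj (t p) * t q * (cnj (F p i) * F q i))"
      unfolding cnj_sum sum_product by (intro sum.cong refl) (simp add: mult_ac)
    also have "\<dots> = (\<Sum>p<k. \<Sum>q<k. \<Sum>i\<in>I. cnj (t p) * t q * (cnj (F p i) * F q i))"
      by (subst sum.swap) (intro sum.cong refl sum.swap)
    also have "\<dots> = (\<Sum>p<k. \<Sum>q<k. cnj (t p) * t q * (if p = q then 1 else 0))"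
      using assms(2) by (intro sum.cong refl) (simp add: sum_distrib_left[symmetric] orthonormal_frame_def)
    also have "\<dots> = (\<Sum>p<k. t p * cnj (t p))"
      by (simp add: mult.commute if_distrib cong: if_cong)
    finally show ?thesis .
  qed
  have "(\<Sum>i\<in>I. cnj (z i) * z i)
     = (\<Sum>i\<in>I. cnj (of_real (w i)) * of_real (w i))
       - (\<Sum>i\<in>I. cnj (of_real (w i)) * (\<Sum>p<k. t p * F p i))
       - (\<Sum>i\<in>I. cnj (\<Sum>p<k. t p * F p i) * of_real (w i))
       + (\<Sum>i\<in>I. cnj (\<Sum>p<k. t p * F p i) * (\<Sum>q<k. t q * F q i))"
    unfolding z_def sum_subtractf[symmetric] sum.distrib[symmetric]
    by (intro sum.cong refl) (simp add: algebra_simps)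
  also have "\<dots> = (\<Sum>i\<in>I. of_real ((w i)\<^sup>2)) - (\<Sum>p<k. t p * cnj (t p))"
    unfolding cross cross' sq by (simp add: power2_eq_square)
  finally have eq: "(\<Sum>i\<in>I. cnj (z i) * z i) = (\<Sum>i\<in>I. of_real ((w i)\<^sup>2)) - (\<Sum>p<k. t p * cnj (t p))" .
  have "of_real (\<Sum>i\<in>I. (cmod (z i))\<^sup>2) = (\<Sum>i\<in>I. cnj (z i) * z i)"
    unfolding of_real_sum complex_norm_square by (simp add: mult.commute)
  also have "\<dots> = of_real ((\<Sum>i\<in>I. (w i)\<^sup>2) - (\<Sum>p<k. (cmod (cnj (t p)))\<^sup>2))"
    unfolding eq by (simp only: of_real_diff of_real_sum complex_norm_square complex_mod_cnj)
  finally have "(\<Sum>i\<in>I. (cmod (z i))\<^sup>2) = (\<Sum>i\<in>I. (w i)\<^sup>2) - (\<Sum>p<k. (cmod (cnj (t p)))\<^sup>2)"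
    by (simp only: of_real_eq_iff)
  moreover have "(\<Sum>i\<in>I. (cmod (z i))\<^sup>2) \<ge> 0" by (simp add: sum_nonneg)
  ultimately show ?thesis unfolding t_cnj by simp
qed

text \<open>\<open>kernel_form_mono\<close> raises all bonds to 1, where the form becomes the
  squared modulus of the pairing with \<open>w\<close>; Bessel's inequality then bounds its trace
  over any frame.\<close>

lemma sum_kernel_form_le:
  assumes "orthonormal_frame {lo..hi} F k" "\<And>i. 0 \<le> c i" "\<And>i. c i \<le> 1"
  shows "(\<Sum>p<k. kernel_form {lo..hi} w c (F p)) \<le> (\<Sum>i\<in>{lo..hi}. (w i)\<^sup>2)"
proof -
  obtain F' where F': "orthonormal_frame {lo..hi} F' k"
    "(\<Sum>p<k. kernel_form {lo..hi} w c (F p)) \<le> (\<Sum>p<k. kernel_form {lo..hi} w (\<lambda>_. 1) (F' p))"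
    using kernel_form_mono[OF assms(1), of c "\<lambda>_. 1"] assms(2,3) by blast
  have "kernel_form {lo..hi} w (\<lambda>_. 1) v = (cmod (\<Sum>i\<in>{lo..hi}. of_real (w i) * v i))\<^sup>2" for v
    unfolding kernel_form_def bond_prod_def power2_norm_eq_inner inner_sum_left inner_sum_right
    by (intro sum.cong refl) (simp add: inner_complex_def algebra_simps)
  then show ?thesis using F' bessel_frame[of "{lo..hi}" F' k w] by simp
qed

section \<open>Enlarging an orthonormal frame\<close>

lemma homogeneous_system_nontrivial:
  fixes A :: "'p \<Rightarrow> 'x \<Rightarrow> 'f::field"
  assumes "finite P" "finite X" "card P < card X"
  shows "\<exists>x. (\<exists>j\<in>X. x j \<noteq> 0) \<and> (\<forall>p\<in>P. (\<Sum>j\<in>X. A p j * x j) = 0)"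
  using assms
proof (induction P arbitrary: X A rule: finite_induct)
  case empty
  then have "X \<noteq> {}" by auto
  then show ?case by (intro exI[of _ "\<lambda>_. 1"]) auto
next
  case (insert p P)
  show ?case
  proof (cases "\<forall>j\<in>X. A p j = 0")
    case True
    have "card P < card X" using insert by simp
    then show ?thesis using insert.IH[OF insert.prems(1), of A] True by auto
  next
    case False
    then obtain j0 where j0: "j0 \<in> X" "A p j0 \<noteq> 0" by auto
    \<comment> \<open>Gaussian elimination: equation \<open>p\<close> is solved for the unknown
      \<open>j0\<close> and inserted into the others; the value at \<open>j0\<close> is put back in
      \<open>y\<close>.\<close>
    define A' where "A' q j = A q j - A q j0 * A p j / A p j0" for q j
    have "card P < card (X - {j0})" using insert j0 by simp
    then obtain x where x: "\<exists>j\<in>X - {j0}. x j \<noteq> 0"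
      "\<And>q. q \<in> P \<Longrightarrow> (\<Sum>j\<in>X - {j0}. A' q j * x j) = 0"
      using insert.IH[of "X - {j0}" A'] insert.prems by auto
    define s where "s = (\<Sum>j\<in>X - {j0}. A p j * x j)"
    define y where "y = x(j0 := - s / A p j0)"
    have split: "(\<Sum>j\<in>X. A q j * y j) = A q j0 * (- s / A p j0) + (\<Sum>j\<in>X - {j0}. A q j * x j)" for q
    proof -
      have "(\<Sum>j\<in>X. A q j * y j) = A q j0 * y j0 + (\<Sum>j\<in>X - {j0}. A q j * y j)"
        using insert.prems(1) j0(1) by (rule sum.remove)
      also have "(\<Sum>j\<in>X - {j0}. A q j * y j) = (\<Sum>j\<in>X - {j0}. A q j * x j)"
        by (rule sum.cong) (auto simp: y_def)
      finally show ?thesis by (simp add: y_def)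
    qed
    have "(\<Sum>j\<in>X. A q j * y j) = 0" if "q \<in> P" for q
    proof -
      have "(\<Sum>j\<in>X - {j0}. A' q j * x j)
          = (\<Sum>j\<in>X - {j0}. A q j * x j) - A q j0 / A p j0 * s"
        unfolding A'_def s_def sum_distrib_left sum_subtractf[symmetric]
        by (rule sum.cong) (auto simp: algebra_simps)
      then show ?thesis using x(2)[OF that] unfolding split by simp
    qed
    moreover have "(\<Sum>j\<in>X. A p j * y j) = 0" unfolding split using j0 by (simp add: s_def)
    moreover have "\<exists>j\<in>X. y j \<noteq> 0" using x(1) by (auto simp: y_def)
    ultimately show ?thesis by blast
  qed
qed

lemma kernel_form_scale:
  "kernel_form I w c (\<lambda>i. of_real r * v i) = r\<^sup>2 * kernel_form I w c v"
  unfolding kernel_form_def sum_distrib_left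
  by (intro sum.cong refl) (simp add: inner_complex_def power2_eq_square algebra_simps)

text \<open>By the assumption, the \<open>k + 1\<close> vectors \<open>f\<close> span a space of
  dimension \<open>k + 1\<close> on which the form is at least \<omega>. This space meets the
  orthogonal complement of the \<open>k\<close> frame vectors, and a unit vector found there is
  appended.\<close>

lemma orthonormal_frame_extend:
  assumes I: "finite I" and F: "orthonormal_frame I F k"
    and f: "\<And>x v. \<exists>j\<le>k. x j \<noteq> 0 \<Longrightarrow> v = (\<lambda>i. \<Sum>j\<le>k. x j * f j i) \<Longrightarrow>
      0 < (\<Sum>i\<in>I. (cmod (v i))\<^sup>2) \<and> \<omega> * (\<Sum>i\<in>I. (cmod (v i))\<^sup>2) \<le> kernel_form I w c v"
  shows "\<exists>F'. orthonormal_frame I F' (Suc k) \<and>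
    (\<Sum>p<k. kernel_form I w c (F p)) + \<omega> \<le> (\<Sum>p<Suc k. kernel_form I w c (F' p))"
proof -
  obtain x where x: "\<exists>j\<in>{..k}. x j \<noteq> 0"
    "\<And>p. p < k \<Longrightarrow> (\<Sum>j\<in>{..k}. (\<Sum>i\<in>I. cnj (F p i) * f j i) * x j) = 0"
    using homogeneous_system_nontrivial[of "{..<k}" "{..k}" "\<lambda>p j. \<Sum>i\<in>I. cnj (F p i) * f j i"] by auto
  define v where "v = (\<lambda>i. \<Sum>j\<le>k. x j * f j i)"
  define N where "N = (\<Sum>i\<in>I. (cmod (v i))\<^sup>2)"
  have N: "0 < N" "\<omega> * N \<le> kernel_form I w c v"
    using f[OF _ v_def] x(1) unfolding N_def by auto
  define e where "e = (\<lambda>i. of_real (1 / sqrt N) * v i)"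
  have ortho: "(\<Sum>i\<in>I. cnj (F p i) * e i) = 0" if "p < k" for p
  proof -
    have "(\<Sum>i\<in>I. cnj (F p i) * v i) = (\<Sum>i\<in>I. \<Sum>j\<le>k. cnj (F p i) * f j i * x j)"
      unfolding v_def by (simp add: sum_distrib_left mult_ac)
    also have "\<dots> = (\<Sum>j\<le>k. (\<Sum>i\<in>I. cnj (F p i) * f j i) * x j)"
      by (subst sum.swap) (simp add: sum_distrib_right)
    finally have "(\<Sum>i\<in>I. cnj (F p i) * v i) = 0" using x(2)[OF that] by simp
    moreover have "(\<Sum>i\<in>I. cnj (F p i) * e i) = of_real (1 / sqrt N) * (\<Sum>i\<in>I. cnj (F p i) * v i)"
      unfolding e_def sum_distrib_left by (intro sum.cong refl) (simp only: mult_ac)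
    ultimately show ?thesis by simp
  qed
  have ortho': "(\<Sum>i\<in>I. cnj (e i) * F p i) = 0" if "p < k" for p
    using arg_cong[OF ortho[OF that], of cnj] by (simp add: mult.commute)
  have "(\<Sum>i\<in>I. cnj (v i) * v i) = of_real N"
    unfolding N_def of_real_sum complex_norm_square by (simp add: mult.commute)
  moreover have "(\<Sum>i\<in>I. cnj (e i) * e i) = of_real ((1 / sqrt N)\<^sup>2) * (\<Sum>i\<in>I. cnj (v i) * v i)"
    unfolding e_def sum_distrib_left
    by (intro sum.cong refl)
      (simp only: complex_cnj_mult complex_cnj_complex_of_real power2_eq_square of_real_mult mult_ac)
  ultimately have norm: "(\<Sum>i\<in>I. cnj (e i) * e i) = 1"
    using N(1) by (simp add: power_divide flip: of_real_power)
  have "orthonormal_frame I (F(k := e)) (Suc k)"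
    using F ortho ortho' norm unfolding orthonormal_frame_def by (auto simp: less_Suc_eq)
  moreover have "kernel_form I w c e \<ge> \<omega>"
    unfolding e_def kernel_form_scale using N by (simp add: power_divide field_simps)
  moreover have "(\<Sum>p<k. kernel_form I w c ((F(k := e)) p)) = (\<Sum>p<k. kernel_form I w c (F p))"
    by (rule sum.cong) auto
  ultimately show ?thesis by (intro exI[of _ "F(k := e)"]) simp
qed

section \<open>Green function of a Jacobi matrix with bonds at most 1\<close>

text \<open>By the Schur complement this is the entry at the last site of the inverse of
  \<open>E\<close> minus the Jacobi matrix on \<open>k + 1\<close> sites with zero diagonal and
  bonds \<open>h 0\<close>, ..., \<open>h (k - 1)\<close>.\<close>

fun cont_frac :: "(nat \<Rightarrow> real) \<Rightarrow> real \<Rightarrow> nat \<Rightarrow> real" where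
  "cont_frac h E 0 = 1 / E"
| "cont_frac h E (Suc k) = 1 / (E - (h k)\<^sup>2 * cont_frac h E k)"

lemma cont_frac_bounds:
  assumes E: "E > 2" and h: "\<And>k. 0 \<le> h k" "\<And>k. h k \<le> 1"
  shows "0 < cont_frac h E k" "cont_frac h E k \<le> (E - sqrt (E\<^sup>2 - 4)) / 2"
proof -
  \<comment> \<open>\<beta> is the smaller root of \<beta> (E - \<beta>) = 1, hence a fixed point of
    the recursion with all bonds 1. It bounds the start value 1 / E, and bonds at most 1 keep every
    later denominator at least E - \<beta>.\<close>
  define \<beta> where "\<beta> = (E - sqrt (E\<^sup>2 - 4)) / 2"
  have E2: "E\<^sup>2 > 4" using E power_strict_mono[of 2 E 2] by simp
  then have "\<beta> * (E - \<beta>) = 1"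
    unfolding \<beta>_def by (simp add: field_simps flip: power2_eq_square)
  moreover have "sqrt (E\<^sup>2 - 4) < E" using E by (intro real_less_lsqrt) auto
  then have "\<beta> > 0" unfolding \<beta>_def by simp
  moreover have "E + sqrt (E\<^sup>2 - 4) > 0" using E E2 by (intro add_pos_pos) auto
  then have "E - \<beta> > 0" unfolding \<beta>_def by (simp add: field_simps)
  ultimately have \<beta>: "\<beta> > 0" "E - \<beta> > 0" "1 / (E - \<beta>) = \<beta>" by (auto simp: field_simps)
  have "0 < cont_frac h E k \<and> cont_frac h E k \<le> \<beta>"
  proof (induction k)
    case 0
    have "1 / E \<le> 1 / (E - \<beta>)" using \<beta> E by (intro divide_left_mono) auto
    then show ?case using \<beta> E by simp
  next
    case (Suc k)
    have "(h k)\<^sup>2 \<le> 1" using h[of k] by (simp add: power_le_one)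
    then have "(h k)\<^sup>2 * cont_frac h E k \<le> 1 * \<beta>" using Suc by (intro mult_mono) auto
    then have "E - (h k)\<^sup>2 * cont_frac h E k \<ge> E - \<beta>" by simp
    then have "1 / (E - (h k)\<^sup>2 * cont_frac h E k) \<le> 1 / (E - \<beta>)"
      using \<beta> by (intro divide_left_mono) auto
    then show ?case using \<beta> \<open>E - (h k)\<^sup>2 * cont_frac h E k \<ge> E - \<beta>\<close> by simp
  qed
  then show "0 < cont_frac h E k" "cont_frac h E k \<le> (E - sqrt (E\<^sup>2 - 4)) / 2"
    unfolding \<beta>_def by auto
qed

lemma cont_frac_le_1:
  assumes E: "E > 2" and h: "\<And>k. 0 \<le> h k" "\<And>k. h k \<le> 1"
  shows "cont_frac h E k \<le> 1"
proof -
  have "(E - 2)\<^sup>2 \<le> E\<^sup>2 - 4" using E by (simp add: power2_eq_square algebra_simps)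
  then have "E - 2 \<le> sqrt (E\<^sup>2 - 4)" by (rule real_le_rsqrt)
  then show ?thesis using cont_frac_bounds(2)[of E h k] assms by simp
qed

text \<open>A larger energy enlarges the leading term of each denominator and, by induction, lowers
  the subtracted fraction. The bound by 1 keeps the denominators positive, as \<open>E\<close>
  exceeds 2.\<close>

lemma cont_frac_antimono:
  assumes E: "E > 2" "E \<le> E'" and h: "\<And>k. 0 \<le> h k" "\<And>k. h k \<le> 1"
  shows "cont_frac h E' k \<le> cont_frac h E k"
proof (induction k)
  case 0
  then show ?case using E by (auto intro!: divide_left_mono)
next
  case (Suc k)
  have "(h k)\<^sup>2 * cont_frac h E' k \<le> (h k)\<^sup>2 * cont_frac h E k"
    using Suc by (rule mult_left_mono) simp
  moreover have "(h k)\<^sup>2 \<le> 1" using h[of k] by (simp add: power_le_one)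
  then have "(h k)\<^sup>2 * cont_frac h E k \<le> 1 * 1"
    using cont_frac_le_1[of E h k] cont_frac_bounds(1)[of E h k] E(1) h by (intro mult_mono) (auto simp: less_imp_le)
  ultimately show ?case using E by (auto intro!: divide_left_mono mult_pos_pos)
qed

text \<open>Moving the index by one only exchanges the terms at \<open>lo - 1\<close> and
  \<open>hi\<close>, and both vanish because no bond leaves the block.\<close>

lemma sum_bond_shift:
  fixes \<delta> :: "int \<Rightarrow> real" and g :: "int \<Rightarrow> 'a::real_vector"
  assumes "\<And>i. i < lo \<or> hi \<le> i \<Longrightarrow> \<delta> i = 0"
  shows "(\<Sum>i\<in>{lo..hi}. \<delta> (i - 1) *\<^sub>R g (i - 1)) = (\<Sum>i\<in>{lo..hi}. \<delta> i *\<^sub>R g i)"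
proof -
  have "(\<Sum>i\<in>{lo..hi}. \<delta> (i - 1) *\<^sub>R g (i - 1)) = (\<Sum>i\<in>{lo - 1..hi - 1}. \<delta> i *\<^sub>R g i)"
    by (rule sum.reindex_bij_witness[of _ "\<lambda>i. i + 1" "\<lambda>i. i - 1"]) auto
  also have "\<dots> = (\<Sum>i\<in>{lo - 1..hi}. \<delta> i *\<^sub>R g i)"
    by (rule sum.mono_neutral_left) (auto simp: assms)
  also have "\<dots> = (\<Sum>i\<in>{lo..hi}. \<delta> i *\<^sub>R g i)"
    by (rule sum.mono_neutral_right) (auto simp: assms)
  finally show ?thesis .
qed

text \<open>Each bond term is bounded by 2 (x \<bullet> y) \<le> |x|^2 + |y|^2 and charged to both
  ends of the bond, so every site collects its two adjacent weights.\<close>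

lemma bond_form_le:
  fixes \<delta> :: "int \<Rightarrow> real" and u :: "int \<Rightarrow> complex"
  assumes nonneg: "\<And>i. 0 \<le> \<delta> i" and outside: "\<And>i. i < lo \<or> hi \<le> i \<Longrightarrow> \<delta> i = 0"
  shows "(\<Sum>i\<in>{lo..hi}. \<delta> (i - 1) * (u (i - 1) \<bullet> u i) + \<delta> i * (u (i + 1) \<bullet> u i))
    \<le> (\<Sum>i\<in>{lo..hi}. (\<delta> (i - 1) + \<delta> i) * (cmod (u i))\<^sup>2)"
proof -
  note shift = sum_bond_shift[of lo hi \<delta>, OF outside]
  have cs: "2 * (u i \<bullet> u (i + 1)) \<le> (cmod (u i))\<^sup>2 + (cmod (u (i + 1)))\<^sup>2" for i
    using inner_ge_zero[of "u i - u (i + 1)"]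
    by (simp add: power2_norm_eq_inner inner_diff_left inner_diff_right inner_commute)
  have "(\<Sum>i\<in>{lo..hi}. \<delta> (i - 1) * (u (i - 1) \<bullet> u i) + \<delta> i * (u (i + 1) \<bullet> u i))
      = (\<Sum>i\<in>{lo..hi}. \<delta> (i - 1) *\<^sub>R (u (i - 1) \<bullet> u (i - 1 + 1))) + (\<Sum>i\<in>{lo..hi}. \<delta> i * (u i \<bullet> u (i + 1)))"
    by (simp add: sum.distrib inner_commute)
  also have "(\<Sum>i\<in>{lo..hi}. \<delta> (i - 1) *\<^sub>R (u (i - 1) \<bullet> u (i - 1 + 1))) = (\<Sum>i\<in>{lo..hi}. \<delta> i *\<^sub>R (u i \<bullet> u (i + 1)))"
    by (rule shift)
  also have "\<dots> + (\<Sum>i\<in>{lo..hi}. \<delta> i * (u i \<bullet> u (i + 1))) = (\<Sum>i\<in>{lo..hi}. \<delta> i * (2 * (u i \<bullet> u (i + 1))))"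
    unfolding sum.distrib[symmetric] by (intro sum.cong refl) simp
  also have "\<dots> \<le> (\<Sum>i\<in>{lo..hi}. \<delta> i * ((cmod (u i))\<^sup>2 + (cmod (u (i + 1)))\<^sup>2))"
    by (intro sum_mono mult_left_mono cs nonneg)
  also have "\<dots> = (\<Sum>i\<in>{lo..hi}. \<delta> i * (cmod (u i))\<^sup>2) + (\<Sum>i\<in>{lo..hi}. \<delta> i *\<^sub>R (cmod (u (i + 1)))\<^sup>2)"
    by (simp add: sum.distrib algebra_simps)
  also have "(\<Sum>i\<in>{lo..hi}. \<delta> i *\<^sub>R (cmod (u (i + 1)))\<^sup>2) = (\<Sum>i\<in>{lo..hi}. \<delta> (i - 1) *\<^sub>R (cmod (u (i - 1 + 1)))\<^sup>2)"
    by (rule shift[symmetric])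
  finally show ?thesis by (simp add: sum.distrib algebra_simps)
qed

text \<open>A finite block is encoded as a two-sided sequence whose bonds vanish outside it. The
  sites \<open>lo\<close> to \<open>hi\<close> then decouple from the rest, and the recursions below
  hold at every integer.\<close>

locale weak_bonds =
  fixes \<alpha> :: "int \<Rightarrow> real" and lo hi :: int
  assumes bond_nonneg: "0 \<le> \<alpha> i" and bond_le_1: "\<alpha> i \<le> 1"
    and bond_outside: "i < lo \<or> hi \<le> i \<Longrightarrow> \<alpha> i = 0"
begin

text \<open>For a site \<open>i\<close> of the block, \<open>L\<close> is the Green function at
  \<open>i\<close> of the chain of sites \<open>lo\<close> to \<open>i\<close>, and \<open>R\<close>
  is that of the sites \<open>i\<close> to \<open>hi\<close>. Beyond the starting end,
  \<open>nat\<close> yields depth 0 and the value 1 / E of an isolated site, which fits the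
  vanishing bonds.\<close>

definition L :: "real \<Rightarrow> int \<Rightarrow> real" where
  "L E i = cont_frac (\<lambda>k. \<alpha> (lo + int k)) E (nat (i - lo))"

definition R :: "real \<Rightarrow> int \<Rightarrow> real" where
  "R E i = cont_frac (\<lambda>k. \<alpha> (hi - 1 - int k)) E (nat (hi - i))"

text \<open>In terms of the full Green function G this is G(i, i+1) / sqrt (G(i, i) G(i+1, i+1)),
  the normalised nearest-neighbour entry.\<close>

definition corr :: "real \<Rightarrow> int \<Rightarrow> real" where
  "corr E i = \<alpha> i * sqrt (L E i * R E (i + 1))"

text \<open>The two subtracted terms are the Schur complement corrections from the half-chains to
  the left and to the right of \<open>i\<close>.\<close>

definition diag :: "real \<Rightarrow> int \<Rightarrow> real" where
  "diag E i = 1 / (E - (\<alpha> (i - 1))\<^sup>2 * L E (i - 1) - (\<alpha> i)\<^sup>2 * R E (i + 1))"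

definition green :: "real \<Rightarrow> int \<Rightarrow> int \<Rightarrow> real" where
  "green E i j = sqrt (diag E i) * sqrt (diag E j) * bond_prod (corr E) i j"

text \<open>Despite the name, this is \<open>E\<close> minus the matrix with bonds \<alpha>; its
  inverse is given by \<open>green\<close>.\<close>

definition resolvent_op :: "real \<Rightarrow> (int \<Rightarrow> complex) \<Rightarrow> int \<Rightarrow> complex" where
  "resolvent_op E u i = E *\<^sub>R u i - \<alpha> (i - 1) *\<^sub>R u (i - 1) - \<alpha> i *\<^sub>R u (i + 1)"

lemma L_rec: "L E i = 1 / (E - (\<alpha> (i - 1))\<^sup>2 * L E (i - 1))"
proof (cases "i > lo")
  case True
  then have "nat (i - lo) = Suc (nat (i - 1 - lo))" by simp
  then show ?thesis using True unfolding L_def by simp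
next
  case False
  then show ?thesis using bond_outside[of "i - 1"] unfolding L_def by simp
qed

lemma R_rec: "R E i = 1 / (E - (\<alpha> i)\<^sup>2 * R E (i + 1))"
proof (cases "i < hi")
  case True
  then have "nat (hi - i) = Suc (nat (hi - (i + 1)))" by simp
  then show ?thesis using True unfolding R_def by simp
next
  case False
  then show ?thesis using bond_outside[of i] unfolding R_def by simp
qed

lemma corr_antimono:
  assumes "2 < E" "E \<le> E'"
  shows "corr E' i \<le> corr E i"
proof -
  have "L E' i * R E' (i + 1) \<le> L E i * R E (i + 1)"
    unfolding L_def R_def using assms bond_nonneg bond_le_1
    by (intro mult_mono cont_frac_antimono less_imp_le[OF cont_frac_bounds(1)]) auto
  then show ?thesis unfolding corr_def
    by (intro mult_left_mono real_sqrt_le_mono bond_nonneg)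
qed

context
  fixes E :: real
  assumes E: "E > 2"
begin

lemma L_bounds: "0 < L E i" "L E i \<le> (E - sqrt (E\<^sup>2 - 4)) / 2" "L E i \<le> 1"
  unfolding L_def by (intro cont_frac_bounds cont_frac_le_1; simp add: E bond_nonneg bond_le_1)+

lemma R_bounds: "0 < R E i" "R E i \<le> (E - sqrt (E\<^sup>2 - 4)) / 2" "R E i \<le> 1"
  unfolding R_def by (intro cont_frac_bounds cont_frac_le_1; simp add: E bond_nonneg bond_le_1)+

lemma sq_gt: "E\<^sup>2 > 4"
  using E power_strict_mono[of 2 E 2] by simp

lemma sqrt_pos: "sqrt (E\<^sup>2 - 4) > 0"
  using sq_gt by simp

lemma corr_nonneg: "0 \<le> corr E i"
  unfolding corr_def using bond_nonneg L_bounds(1) R_bounds(1) by (simp add: less_imp_le)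

lemma corr_le_1: "corr E i \<le> 1"
proof -
  have "L E i * R E (i + 1) \<le> 1"
    using L_bounds R_bounds by (intro mult_le_one) (auto simp: less_imp_le)
  then have "\<alpha> i * sqrt (L E i * R E (i + 1)) \<le> 1"
    using L_bounds(1) R_bounds(1) bond_le_1 by (intro mult_le_one) (auto simp: less_imp_le)
  then show ?thesis unfolding corr_def .
qed

text \<open>Each of the two subtracted terms is at most \<beta> = (E - sqrt (E^2 - 4)) / 2, and E -
  2 \<beta> = sqrt (E^2 - 4).\<close>

lemma diag_denominator: "sqrt (E\<^sup>2 - 4) \<le> E - (\<alpha> (i - 1))\<^sup>2 * L E (i - 1) - (\<alpha> i)\<^sup>2 * R E (i + 1)"
proof -
  have le1: "(\<alpha> j)\<^sup>2 \<le> 1" for j using bond_nonneg bond_le_1 by (simp add: power_le_one)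
  have "(\<alpha> (i - 1))\<^sup>2 * L E (i - 1) \<le> 1 * ((E - sqrt (E\<^sup>2 - 4)) / 2)"
    using le1 L_bounds by (intro mult_mono) (auto simp: less_imp_le)
  moreover have "(\<alpha> i)\<^sup>2 * R E (i + 1) \<le> 1 * ((E - sqrt (E\<^sup>2 - 4)) / 2)"
    using le1 R_bounds by (intro mult_mono) (auto simp: less_imp_le)
  ultimately show ?thesis by (simp add: field_simps)
qed

lemma diag_pos: "diag E i > 0"
  using diag_denominator[of i] sqrt_pos unfolding diag_def by (intro divide_pos_pos) linarith+

lemma diag_le: "sqrt (E\<^sup>2 - 4) * diag E i \<le> 1"
proof -
  have "E - (\<alpha> (i - 1))\<^sup>2 * L E (i - 1) - (\<alpha> i)\<^sup>2 * R E (i + 1) > 0"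
    using diag_denominator[of i] sqrt_pos by linarith
  then show ?thesis using diag_denominator[of i] unfolding diag_def by simp
qed

text \<open>The recursions express both diagonal entries through bond \<open>i\<close> alone:
  \<open>L E i / diag E i\<close> and \<open>R E (i + 1) / diag E (i + 1)\<close> both equal
  \<open>1 - (\<alpha> i)\<^sup>2 * R E (i + 1) * L E i\<close>.\<close>

lemma diag_swap: "diag E i * R E (i + 1) = diag E (i + 1) * L E i"
proof -
  have pos: "L E i > 0" "R E (i + 1) > 0" "diag E i > 0" "diag E (i + 1) > 0"
    using L_bounds R_bounds diag_pos by auto
  have "1 / L E i = E - (\<alpha> (i - 1))\<^sup>2 * L E (i - 1)" by (subst L_rec) simp
  then have 1: "1 / diag E i = 1 / L E i - (\<alpha> i)\<^sup>2 * R E (i + 1)"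
    unfolding diag_def by simp
  have "1 / R E (i + 1) = E - (\<alpha> (i + 1))\<^sup>2 * R E (i + 1 + 1)" by (subst R_rec) simp
  then have 2: "1 / diag E (i + 1) = 1 / R E (i + 1) - (\<alpha> i)\<^sup>2 * L E i"
    unfolding diag_def by simp
  have "L E i * (1 / diag E i) = 1 - (\<alpha> i)\<^sup>2 * R E (i + 1) * L E i"
    unfolding 1 using pos by (simp add: right_diff_distrib)
  moreover have "R E (i + 1) * (1 / diag E (i + 1)) = 1 - (\<alpha> i)\<^sup>2 * R E (i + 1) * L E i"
    unfolding 2 using pos by (simp add: right_diff_distrib)
  ultimately have "L E i / diag E i = R E (i + 1) / diag E (i + 1)" by simp
  then show ?thesis using pos by (simp add: field_simps)
qed

text \<open>The square root of \<open>diag_swap\<close> converts the symmetric bond factor into a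
  one-sided transfer factor, so that the columns of \<open>green\<close> obey first-order
  recursions.\<close>

lemma sqrt_diag_left: "sqrt (diag E i) * corr E i = \<alpha> i * L E i * sqrt (diag E (i + 1))"
proof -
  have "sqrt (diag E i) * sqrt (R E (i + 1)) = sqrt (diag E (i + 1)) * sqrt (L E i)"
    using diag_swap[of i] by (metis real_sqrt_mult)
  moreover have "sqrt (L E i) * sqrt (L E i) = L E i" using L_bounds(1)[of i] by simp
  ultimately show ?thesis unfolding corr_def real_sqrt_mult by (smt (verit) mult.assoc mult.commute)
qed

lemma sqrt_diag_right: "sqrt (diag E (i + 1)) * corr E i = \<alpha> i * R E (i + 1) * sqrt (diag E i)"
proof -
  have "sqrt (diag E i) * sqrt (R E (i + 1)) = sqrt (diag E (i + 1)) * sqrt (L E i)"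
    using diag_swap[of i] by (metis real_sqrt_mult)
  moreover have "sqrt (R E (i + 1)) * sqrt (R E (i + 1)) = R E (i + 1)" using R_bounds(1)[of "i + 1"] by simp
  ultimately show ?thesis unfolding corr_def real_sqrt_mult by (smt (verit) mult.assoc mult.commute)
qed

lemma green_left:
  assumes "i < j"
  shows "green E i j = \<alpha> i * L E i * green E (i + 1) j"
proof -
  have "{i..<j} = insert i {i + 1..<j}" using assms by auto
  then have "bond_prod (corr E) i j = corr E i * bond_prod (corr E) (i + 1) j"
    using assms unfolding bond_prod_def by (simp add: min_def max_def)
  then have "green E i j = (sqrt (diag E i) * corr E i) * sqrt (diag E j) * bond_prod (corr E) (i + 1) j"
    unfolding green_def by (simp only: mult_ac)
  then show ?thesis unfolding sqrt_diag_left green_def by (simp only: mult_ac)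
qed

lemma green_right:
  assumes "j \<le> i"
  shows "green E (i + 1) j = \<alpha> i * R E (i + 1) * green E i j"
proof -
  have "{j..<i + 1} = insert i {j..<i}" using assms by auto
  then have "bond_prod (corr E) (i + 1) j = corr E i * bond_prod (corr E) i j"
    using assms unfolding bond_prod_def by (simp add: min_def max_def)
  then have "green E (i + 1) j = (sqrt (diag E (i + 1)) * corr E i) * sqrt (diag E j) * bond_prod (corr E) i j"
    unfolding green_def by (simp only: mult_ac)
  then show ?thesis unfolding sqrt_diag_right green_def by (simp only: mult_ac)
qed

text \<open>Away from the diagonal the contributions of both neighbours are multiples of
  \<open>green E i j\<close>, and the recursion for \<open>L\<close> or \<open>R\<close> makes the
  three terms cancel. On the diagonal the neighbours use one recursion each and reproduce the
  denominator of \<open>diag\<close>.\<close>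

lemma green_equation:
  "E * green E i j - \<alpha> (i - 1) * green E (i - 1) j - \<alpha> i * green E (i + 1) j = of_bool (i = j)"
proof -
  have L: "1 / L E i = E - (\<alpha> (i - 1))\<^sup>2 * L E (i - 1)" by (subst L_rec) simp
  have R: "1 / R E i = E - (\<alpha> i)\<^sup>2 * R E (i + 1)" by (subst R_rec) simp
  consider "i < j" | "i = j" | "j < i" by linarith
  then show ?thesis
  proof cases
    case 1
    have "green E (i - 1) j = \<alpha> (i - 1) * L E (i - 1) * green E i j"
      using green_left[of "i - 1" j] 1 by simp
    moreover have "\<alpha> i * green E (i + 1) j = 1 / L E i * green E i j"
      using green_left[OF 1] L_bounds(1)[of i] by simp
    ultimately show ?thesis using 1 unfolding L by (simp add: algebra_simps power2_eq_square)
  next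
    case 2
    have "green E (i - 1) i = \<alpha> (i - 1) * L E (i - 1) * green E i i"
      using green_left[of "i - 1" i] by simp
    moreover have "green E (i + 1) i = \<alpha> i * R E (i + 1) * green E i i"
      using green_right[of i i] by simp
    moreover have "green E i i = diag E i"
      using diag_pos[of i] unfolding green_def bond_prod_def by simp
    moreover have "diag E i * (E - (\<alpha> (i - 1))\<^sup>2 * L E (i - 1) - (\<alpha> i)\<^sup>2 * R E (i + 1)) = 1"
      using diag_pos[of i] unfolding diag_def by auto
    ultimately show ?thesis using 2 by (simp add: algebra_simps power2_eq_square)
  next
    case 3
    have "\<alpha> (i - 1) * green E (i - 1) j = 1 / R E i * green E i j"
      using green_right[of j "i - 1"] 3 R_bounds(1)[of i] by simp
    moreover have "green E (i + 1) j = \<alpha> i * R E (i + 1) * green E i j"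
      using green_right[of j i] 3 by simp
    ultimately show ?thesis using 3 unfolding R by (simp add: algebra_simps power2_eq_square)
  qed
qed

end

section \<open>Birman-Schwinger principle and the endpoint bound\<close>

lemma resolvent_op_symmetric:
  "(\<Sum>i\<in>{lo..hi}. resolvent_op E u i \<bullet> z i) = (\<Sum>i\<in>{lo..hi}. u i \<bullet> resolvent_op E z i)"
proof -
  note shift = sum_bond_shift[of lo hi \<alpha>, OF bond_outside]
  have "(\<Sum>i\<in>{lo..hi}. resolvent_op E u i \<bullet> z i) = (\<Sum>i\<in>{lo..hi}. E * (u i \<bullet> z i))
      - (\<Sum>i\<in>{lo..hi}. \<alpha> (i - 1) *\<^sub>R (u (i - 1) \<bullet> z (i - 1 + 1))) - (\<Sum>i\<in>{lo..hi}. \<alpha> i *\<^sub>R (u (i + 1) \<bullet> z i))"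
    unfolding resolvent_op_def by (simp add: inner_diff_left sum_subtractf)
  also have "(\<Sum>i\<in>{lo..hi}. \<alpha> (i - 1) *\<^sub>R (u (i - 1) \<bullet> z (i - 1 + 1))) = (\<Sum>i\<in>{lo..hi}. \<alpha> i *\<^sub>R (u i \<bullet> z (i + 1)))"
    by (rule shift)
  also have "(\<Sum>i\<in>{lo..hi}. \<alpha> i *\<^sub>R (u (i + 1) \<bullet> z i)) = (\<Sum>i\<in>{lo..hi}. \<alpha> (i - 1) *\<^sub>R (u (i - 1 + 1) \<bullet> z (i - 1)))"
    by (rule shift[symmetric])
  finally show ?thesis
    unfolding resolvent_op_def by (simp add: inner_diff_right sum_subtractf)
qed

text \<open>Adjacent bonds sum to at most 2, so by \<open>bond_form_le\<close> the matrix with bonds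
  \<alpha> has form at most 2.\<close>

lemma resolvent_op_lower:
  "(E - 2) * (\<Sum>i\<in>{lo..hi}. (cmod (u i))\<^sup>2) \<le> (\<Sum>i\<in>{lo..hi}. resolvent_op E u i \<bullet> u i)"
proof -
  have "(\<Sum>i\<in>{lo..hi}. resolvent_op E u i \<bullet> u i) = E * (\<Sum>i\<in>{lo..hi}. (cmod (u i))\<^sup>2)
      - (\<Sum>i\<in>{lo..hi}. \<alpha> (i - 1) * (u (i - 1) \<bullet> u i) + \<alpha> i * (u (i + 1) \<bullet> u i))"
    unfolding resolvent_op_def sum_distrib_left sum_subtractf[symmetric]
    by (intro sum.cong refl) (simp add: inner_diff_left power2_norm_eq_inner)
  moreover have "(\<Sum>i\<in>{lo..hi}. \<alpha> (i - 1) * (u (i - 1) \<bullet> u i) + \<alpha> i * (u (i + 1) \<bullet> u i))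
      \<le> (\<Sum>i\<in>{lo..hi}. (\<alpha> (i - 1) + \<alpha> i) * (cmod (u i))\<^sup>2)"
    by (rule bond_form_le) (auto simp: bond_nonneg bond_outside)
  moreover have "(\<Sum>i\<in>{lo..hi}. (\<alpha> (i - 1) + \<alpha> i) * (cmod (u i))\<^sup>2) \<le> (\<Sum>i\<in>{lo..hi}. 2 * (cmod (u i))\<^sup>2)"
  proof (intro sum_mono mult_right_mono)
    show "\<alpha> (i - 1) + \<alpha> i \<le> 2" for i
      using bond_le_1[of i] bond_le_1[of "i - 1"] by linarith
  qed simp
  ultimately show ?thesis
    by (simp only: sum_distrib_left[symmetric] left_diff_distrib)
qed

text \<open>With \<open>A = E - J\<close> and \<open>G\<close> its inverse, expanding \<open>\<langle>A (G y - u), G y - u\<rangle> \<ge> 0\<close> at \<open>y = W u\<close>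
  turns \<open>\<langle>A u, u\<rangle> \<le> \<langle>W u, u\<rangle>\<close> into \<open>\<langle>W u, u\<rangle> \<le> \<langle>G W u, W u\<rangle>\<close>.\<close>

lemma birman_schwinger:
  assumes E: "E > 2" and W: "\<And>i. 0 \<le> W i"
    and pos: "0 < (\<Sum>i\<in>{lo..hi}. (cmod (u i))\<^sup>2)"
    and le: "(\<Sum>i\<in>{lo..hi}. resolvent_op E u i \<bullet> u i) \<le> (\<Sum>i\<in>{lo..hi}. W i * (cmod (u i))\<^sup>2)"
    and v: "v = (\<lambda>i. of_real (sqrt (W i * diag E i)) * u i)"
  shows "0 < (\<Sum>i\<in>{lo..hi}. (cmod (v i))\<^sup>2) \<and>
    sqrt (E\<^sup>2 - 4) * (\<Sum>i\<in>{lo..hi}. (cmod (v i))\<^sup>2)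
      \<le> kernel_form {lo..hi} (\<lambda>i. sqrt (W i)) (corr E) v"
proof -
  define y where "y i = W i *\<^sub>R u i" for i
  define g where "g i = (\<Sum>j\<in>{lo..hi}. green E i j *\<^sub>R y j)" for i
  define D where "D = (\<Sum>i\<in>{lo..hi}. W i * (cmod (u i))\<^sup>2)"
  have norm_v: "(cmod (v i))\<^sup>2 = diag E i * (W i * (cmod (u i))\<^sup>2)" for i
    using W[of i] diag_pos[OF E, of i] unfolding v by (simp add: norm_mult power_mult_distrib)
  have Ag: "resolvent_op E g i = y i" if "i \<in> {lo..hi}" for i
  proof -
    have "resolvent_op E g i = (\<Sum>j\<in>{lo..hi}.
        (E * green E i j - \<alpha> (i - 1) * green E (i - 1) j - \<alpha> i * green E (i + 1) j) *\<^sub>R y j)"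
      unfolding resolvent_op_def g_def
      by (simp add: scaleR_sum_right sum_subtractf scaleR_diff_left)
    also have "\<dots> = (\<Sum>j\<in>{lo..hi}. if j = i then y j else 0)"
      unfolding green_equation[OF E] by (intro sum.cong) auto
    also have "\<dots> = y i" using that by simp
    finally show ?thesis .
  qed
  define z where "z i = g i - u i" for i
  have yu: "(\<Sum>i\<in>{lo..hi}. y i \<bullet> u i) = D"
    unfolding D_def y_def by (simp add: power2_norm_eq_inner)
  have "resolvent_op E z i = resolvent_op E g i - resolvent_op E u i" for i
    unfolding resolvent_op_def z_def by (simp add: algebra_simps)
  then have "(\<Sum>i\<in>{lo..hi}. resolvent_op E z i \<bullet> z i) =
      (\<Sum>i\<in>{lo..hi}. resolvent_op E g i \<bullet> g i) - (\<Sum>i\<in>{lo..hi}. resolvent_op E g i \<bullet> u i)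
      - (\<Sum>i\<in>{lo..hi}. resolvent_op E u i \<bullet> g i) + (\<Sum>i\<in>{lo..hi}. resolvent_op E u i \<bullet> u i)"
    unfolding z_def by (simp add: inner_diff_left inner_diff_right sum_subtractf)
  also have "(\<Sum>i\<in>{lo..hi}. resolvent_op E u i \<bullet> g i) = (\<Sum>i\<in>{lo..hi}. resolvent_op E g i \<bullet> u i)"
    unfolding resolvent_op_symmetric[of E u g] by (simp add: inner_commute)
  also have "(\<Sum>i\<in>{lo..hi}. resolvent_op E g i \<bullet> u i) = D"
    unfolding yu[symmetric] by (intro sum.cong refl) (simp add: Ag)
  also have "(\<Sum>i\<in>{lo..hi}. resolvent_op E g i \<bullet> g i) = (\<Sum>i\<in>{lo..hi}. y i \<bullet> g i)"
    by (intro sum.cong refl) (simp add: Ag)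
  finally have "(\<Sum>i\<in>{lo..hi}. resolvent_op E z i \<bullet> z i) \<le> (\<Sum>i\<in>{lo..hi}. y i \<bullet> g i) - D"
    using le unfolding D_def by simp
  moreover have "0 \<le> (\<Sum>i\<in>{lo..hi}. resolvent_op E z i \<bullet> z i)"
    by (rule order_trans[OF _ resolvent_op_lower]) (use E in \<open>simp add: sum_nonneg\<close>)
  ultimately have "D \<le> (\<Sum>i\<in>{lo..hi}. y i \<bullet> g i)" by simp
  also have "\<dots> = kernel_form {lo..hi} (\<lambda>i. sqrt (W i)) (corr E) v"
  proof -
    \<comment> \<open>The factors sqrt (diag E i) of the Green function move into \<open>v\<close>,
      which leaves the kernel of bond products.\<close>
    have "y i \<bullet> (green E i j *\<^sub>R y j)
        = sqrt (W i) * sqrt (W j) * bond_prod (corr E) i j * (v i \<bullet> v j)" for i j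
    proof -
      have v': "v i = (sqrt (W i) * sqrt (diag E i)) *\<^sub>R u i" for i
        unfolding v by (simp add: real_sqrt_mult scaleR_conv_of_real)
      have W': "W i = sqrt (W i) * sqrt (W i)" for i using W by simp
      show ?thesis unfolding v' y_def green_def
        by (subst (1) W', subst (2) W') (simp add: mult_ac)
    qed
    then show ?thesis unfolding kernel_form_def g_def inner_sum_right by simp
  qed
  finally have D: "D \<le> kernel_form {lo..hi} (\<lambda>i. sqrt (W i)) (corr E) v" .
  have "sqrt (E\<^sup>2 - 4) * (\<Sum>i\<in>{lo..hi}. (cmod (v i))\<^sup>2)
      = (\<Sum>i\<in>{lo..hi}. (sqrt (E\<^sup>2 - 4) * diag E i) * (W i * (cmod (u i))\<^sup>2))"
    unfolding norm_v sum_distrib_left by (simp only: mult_ac)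
  also have "\<dots> \<le> (\<Sum>i\<in>{lo..hi}. 1 * (W i * (cmod (u i))\<^sup>2))"
    by (intro sum_mono mult_right_mono diag_le[OF E]) (simp add: W)
  finally have 1: "sqrt (E\<^sup>2 - 4) * (\<Sum>i\<in>{lo..hi}. (cmod (v i))\<^sup>2) \<le> D" by (simp add: D_def)
  \<comment> \<open>On the block \<open>v\<close> could vanish only if \<open>W\<close> vanished
    wherever \<open>u\<close> does not. The lower bound E - 2 for the form of
    \<open>resolvent_op\<close> excludes this.\<close>
  have "0 < (E - 2) * (\<Sum>i\<in>{lo..hi}. (cmod (u i))\<^sup>2)" using E pos by simp
  also have "\<dots> \<le> D" using resolvent_op_lower le unfolding D_def by (rule order_trans)
  finally have "D \<noteq> 0" by simp
  then obtain i where i: "i \<in> {lo..hi}" "W i * (cmod (u i))\<^sup>2 \<noteq> 0"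
    unfolding D_def by (meson sum.not_neutral_contains_not_neutral)
  then have "0 < (cmod (v i))\<^sup>2" unfolding norm_v using diag_pos[OF E, of i] W[of i] by simp
  then have "0 < (\<Sum>i\<in>{lo..hi}. (cmod (v i))\<^sup>2)"
    using i(1) by (intro sum_pos2[of _ i]) auto
  then show ?thesis using 1 D by simp
qed

text \<open>The assumption on \<open>f\<close> is the min-max form of \<open>Es k\<close> being at
  most the eigenvalue number \<open>k\<close>, counted from 0 downwards, of the block matrix with
  bonds \<alpha> and diagonal \<open>W\<close>. The frame is enlarged at one energy after another,
  from the largest down.\<close>

lemma sum_sqrt_eigenvalues_le:
  fixes Es :: "nat \<Rightarrow> real"
  assumes E: "\<And>k. k < K \<Longrightarrow> Es k > 2" "\<And>j k. j \<le> k \<Longrightarrow> k < K \<Longrightarrow> Es k \<le> Es j"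
    and W: "\<And>i. 0 \<le> W i"
    and f: "\<And>k x u. k < K \<Longrightarrow> \<exists>j\<le>k. x j \<noteq> 0 \<Longrightarrow> u = (\<lambda>i. \<Sum>j\<le>k. x j * f j i) \<Longrightarrow>
      0 < (\<Sum>i\<in>{lo..hi}. (cmod (u i))\<^sup>2) \<and>
      (\<Sum>i\<in>{lo..hi}. resolvent_op (Es k) u i \<bullet> u i) \<le> (\<Sum>i\<in>{lo..hi}. W i * (cmod (u i))\<^sup>2)"
  shows "(\<Sum>k<K. sqrt ((Es k)\<^sup>2 - 4)) \<le> (\<Sum>i\<in>{lo..hi}. W i)"
proof -
  \<comment> \<open>A frame of length \<open>k\<close> is compared at the last energy used,
    \<open>Es (k - 1)\<close>. For \<open>k = 0\<close> this is \<open>Es 0\<close>, with both sums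
    empty.\<close>
  have "\<exists>F. orthonormal_frame {lo..hi} F k \<and> (\<Sum>j<k. sqrt ((Es j)\<^sup>2 - 4))
      \<le> (\<Sum>p<k. kernel_form {lo..hi} (\<lambda>i. sqrt (W i)) (corr (Es (k - 1))) (F p))" if "k \<le> K" for k :: nat
    using that
  proof (induction k)
    case 0
    then show ?case by (auto simp: orthonormal_frame_def)
  next
    case (Suc k)
    then obtain F where F: "orthonormal_frame {lo..hi} F k" "(\<Sum>j<k. sqrt ((Es j)\<^sup>2 - 4))
      \<le> (\<Sum>p<k. kernel_form {lo..hi} (\<lambda>i. sqrt (W i)) (corr (Es (k - 1))) (F p))" by auto
    have k: "k < K" using Suc by simp
    have "corr (Es (k - 1)) i \<le> corr (Es k) i" "0 \<le> corr (Es (k - 1)) i" for i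
      using E(1)[of k] E(1)[of "k - 1"] E(2)[of "k - 1" k] k
      by (auto intro!: corr_antimono corr_nonneg)
    then obtain F' where F': "orthonormal_frame {lo..hi} F' k" "(\<Sum>j<k. sqrt ((Es j)\<^sup>2 - 4))
      \<le> (\<Sum>p<k. kernel_form {lo..hi} (\<lambda>i. sqrt (W i)) (corr (Es k)) (F' p))"
      using kernel_form_mono[OF F(1), of "corr (Es (k - 1))" "corr (Es k)" "\<lambda>i. sqrt (W i)"] F(2)
      by (meson order_trans)
    \<comment> \<open>The Birman-Schwinger substitution depends on the energy through
      \<open>diag\<close>, so it is made afresh in each step.\<close>
    define f' where "f' j = (\<lambda>i. of_real (sqrt (W i * diag (Es k) i)) * f j i)" for j
    have form: "0 < (\<Sum>i\<in>{lo..hi}. (cmod (v i))\<^sup>2) \<and>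
      sqrt ((Es k)\<^sup>2 - 4) * (\<Sum>i\<in>{lo..hi}. (cmod (v i))\<^sup>2)
        \<le> kernel_form {lo..hi} (\<lambda>i. sqrt (W i)) (corr (Es k)) v"
      if x: "\<exists>j\<le>k. x j \<noteq> 0" and v: "v = (\<lambda>i. \<Sum>j\<le>k. x j * f' j i)" for x v
    proof -
      define u where "u = (\<lambda>i. \<Sum>j\<le>k. x j * f j i)"
      have v': "v = (\<lambda>i. of_real (sqrt (W i * diag (Es k) i)) * u i)"
        unfolding v u_def f'_def sum_distrib_left by (intro ext sum.cong refl) (simp only: mult_ac)
      show ?thesis
        using birman_schwinger[OF E(1)[OF k] W _ _ v'] f[OF k x u_def] by blast
    qed
    have "\<exists>F''. orthonormal_frame {lo..hi} F'' (Suc k) \<and>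
      (\<Sum>p<k. kernel_form {lo..hi} (\<lambda>i. sqrt (W i)) (corr (Es k)) (F' p)) + sqrt ((Es k)\<^sup>2 - 4)
        \<le> (\<Sum>p<Suc k. kernel_form {lo..hi} (\<lambda>i. sqrt (W i)) (corr (Es k)) (F'' p))"
      by (rule orthonormal_frame_extend[where f = f'], simp, rule F'(1), rule form)
    then obtain F'' where "orthonormal_frame {lo..hi} F'' (Suc k)"
      "(\<Sum>p<k. kernel_form {lo..hi} (\<lambda>i. sqrt (W i)) (corr (Es k)) (F' p)) + sqrt ((Es k)\<^sup>2 - 4)
        \<le> (\<Sum>p<Suc k. kernel_form {lo..hi} (\<lambda>i. sqrt (W i)) (corr (Es k)) (F'' p))"
      by blast
    then show ?case using F'(2) by (intro exI[of _ F'']) simp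
  qed
  from this[of K] obtain F where F: "orthonormal_frame {lo..hi} F K" "(\<Sum>j<K. sqrt ((Es j)\<^sup>2 - 4))
      \<le> (\<Sum>p<K. kernel_form {lo..hi} (\<lambda>i. sqrt (W i)) (corr (Es (K - 1))) (F p))" by auto
  show ?thesis
  proof (cases "K = 0")
    case True
    then show ?thesis using W by (simp add: sum_nonneg)
  next
    case False
    then have "Es (K - 1) > 2" using E(1) by simp
    then show ?thesis
      using sum_kernel_form_le[OF F(1), of "corr (Es (K - 1))" "\<lambda>i. sqrt (W i)"] F(2) W
      by (simp add: corr_nonneg corr_le_1)
  qed
qed

end

section \<open>Shifts and integration\<close>

text \<open>The contribution of an eigenvalue \<open>E\<close> of J to the endpoint bound for J - s,
  whose eigenvalue is \<open>E - s\<close>.\<close>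

definition shifted_weight :: "real \<Rightarrow> real \<Rightarrow> real" where
  "shifted_weight E s = (if E - s > 2 then sqrt ((E - s)\<^sup>2 - 4) else 0)"

definition bond_potential :: "(int \<Rightarrow> real) \<Rightarrow> (int \<Rightarrow> real) \<Rightarrow> int \<Rightarrow> real" where
  "bond_potential a b n = pos_part (b n) + pos_part (a n - 1) + pos_part (a (n - 1) - 1)"

text \<open>Cutting the bonds that leave the block makes the two-sided matrix act on the sites
  \<open>lo\<close> to \<open>hi\<close> as the truncated finite matrix.\<close>

definition cut_bonds :: "int \<Rightarrow> int \<Rightarrow> (int \<Rightarrow> real) \<Rightarrow> int \<Rightarrow> real" where
  "cut_bonds lo hi a i = (if lo \<le> i \<and> i < hi then a i else 0)"

text \<open>A bond \<open>a > 1\<close> is replaced by a bond \<open>1\<close> at the cost of adding \<open>a - 1\<close> to the diagonal at both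
  of its ends; bonds \<open>a \<le> 1\<close> stay as they are.\<close>

lemma sum_shifted_weight_le:
  fixes Es :: "nat \<Rightarrow> real"
  assumes a: "\<And>i. 0 \<le> a i"
    and E: "\<And>j k. j \<le> k \<Longrightarrow> k < K \<Longrightarrow> Es k \<le> Es j"
    and f: "\<And>k x u. k < K \<Longrightarrow> \<exists>j\<le>k. x j \<noteq> 0 \<Longrightarrow> u = (\<lambda>i. \<Sum>j\<le>k. x j * f j i) \<Longrightarrow>
      0 < (\<Sum>i\<in>{lo..hi}. (cmod (u i))\<^sup>2) \<and>
      Es k * (\<Sum>i\<in>{lo..hi}. (cmod (u i))\<^sup>2)
        \<le> (\<Sum>i\<in>{lo..hi}. jacobi (cut_bonds lo hi a) b u i \<bullet> u i)"
  shows "(\<Sum>k<K. shifted_weight (Es k) s) \<le> (\<Sum>i\<in>{lo..hi}. pos_part (bond_potential a b i - s))"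
  using E f
proof (induction K)
  case 0
  then show ?case by (simp add: sum_nonneg pos_part_def)
next
  case (Suc K)
  show ?case
  proof (cases "Es K - s > 2")
    \<comment> \<open>The smallest shifted eigenvalue has weight 0 and is dropped, which is why the
      induction is on \<open>K\<close>. In the other case all shifted eigenvalues exceed 2 and the
      endpoint bound applies to the whole list.\<close>
    case False
    then show ?thesis using Suc by (simp add: shifted_weight_def)
  next
    case True
    define a' where "a' = cut_bonds lo hi a"
    define \<alpha> where "\<alpha> i = min (a' i) 1" for i
    define \<delta> where "\<delta> i = a' i - \<alpha> i" for i
    interpret weak_bonds \<alpha> lo hi
      by unfold_locales (auto simp: \<alpha>_def a'_def cut_bonds_def a)
    have \<delta>_nonneg: "0 \<le> \<delta> i" for i by (simp add: \<delta>_def \<alpha>_def)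
    have \<delta>_le: "\<delta> i \<le> pos_part (a i - 1)" for i
      by (auto simp: \<delta>_def \<alpha>_def a'_def cut_bonds_def pos_part_def)
    have gt: "Es k - s > 2" if "k < Suc K" for k
      using Suc.prems(1)[of k K] that True by linarith
    have form: "0 < (\<Sum>i\<in>{lo..hi}. (cmod (u i))\<^sup>2) \<and>
      (\<Sum>i\<in>{lo..hi}. resolvent_op (Es k - s) u i \<bullet> u i)
        \<le> (\<Sum>i\<in>{lo..hi}. pos_part (bond_potential a b i - s) * (cmod (u i))\<^sup>2)"
      if k: "k < Suc K" and x: "\<exists>j\<le>k. x j \<noteq> 0" and u: "u = (\<lambda>i. \<Sum>j\<le>k. x j * f j i)" for k x u
    proof -
      have jac: "jacobi a' b u i \<bullet> u i = b i * (cmod (u i))\<^sup>2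
          + (a' (i - 1) * (u (i - 1) \<bullet> u i) + a' i * (u (i + 1) \<bullet> u i))" for i
        unfolding jacobi_def
        by (simp add: inner_add_left power2_norm_eq_inner flip: scaleR_conv_of_real)
      have res: "resolvent_op (Es k - s) u i \<bullet> u i = (Es k - s) * (cmod (u i))\<^sup>2
          - (\<alpha> (i - 1) * (u (i - 1) \<bullet> u i) + \<alpha> i * (u (i + 1) \<bullet> u i))" for i
        unfolding resolvent_op_def by (simp add: inner_diff_left power2_norm_eq_inner)
      \<comment> \<open>The form splits into that of \<open>Es k\<close> minus the cut matrix, which
        is nonpositive on \<open>u\<close>, the diagonal \<open>b - s\<close>, and the excess
        \<delta> of the bonds over 1.\<close>
      have "(\<Sum>i\<in>{lo..hi}. resolvent_op (Es k - s) u i \<bullet> u i) =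
          Es k * (\<Sum>i\<in>{lo..hi}. (cmod (u i))\<^sup>2) - (\<Sum>i\<in>{lo..hi}. jacobi a' b u i \<bullet> u i)
          + (\<Sum>i\<in>{lo..hi}. (b i - s) * (cmod (u i))\<^sup>2)
          + (\<Sum>i\<in>{lo..hi}. \<delta> (i - 1) * (u (i - 1) \<bullet> u i) + \<delta> i * (u (i + 1) \<bullet> u i))"
        unfolding sum_distrib_left sum_subtractf[symmetric] sum.distrib[symmetric]
        by (intro sum.cong refl) (simp add: jac res \<delta>_def algebra_simps)
      also have "\<dots> \<le> (\<Sum>i\<in>{lo..hi}. (b i - s) * (cmod (u i))\<^sup>2)
          + (\<Sum>i\<in>{lo..hi}. \<delta> (i - 1) * (u (i - 1) \<bullet> u i) + \<delta> i * (u (i + 1) \<bullet> u i))"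
        using Suc.prems(2)[OF k x u] unfolding a'_def by linarith
      also have "(\<Sum>i\<in>{lo..hi}. \<delta> (i - 1) * (u (i - 1) \<bullet> u i) + \<delta> i * (u (i + 1) \<bullet> u i))
          \<le> (\<Sum>i\<in>{lo..hi}. (\<delta> (i - 1) + \<delta> i) * (cmod (u i))\<^sup>2)"
        by (rule bond_form_le) (auto simp: \<delta>_nonneg \<delta>_def \<alpha>_def a'_def cut_bonds_def)
      also have "(\<Sum>i\<in>{lo..hi}. (b i - s) * (cmod (u i))\<^sup>2) + \<dots>
          = (\<Sum>i\<in>{lo..hi}. (b i - s + (\<delta> (i - 1) + \<delta> i)) * (cmod (u i))\<^sup>2)"
        by (simp add: sum.distrib[symmetric] algebra_simps)
      also have "\<dots> \<le> (\<Sum>i\<in>{lo..hi}. pos_part (bond_potential a b i - s) * (cmod (u i))\<^sup>2)"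
      proof (intro sum_mono mult_right_mono)
        show "b i - s + (\<delta> (i - 1) + \<delta> i) \<le> pos_part (bond_potential a b i - s)" for i
          using \<delta>_le[of i] \<delta>_le[of "i - 1"] unfolding bond_potential_def pos_part_def by linarith
      qed simp
      finally show ?thesis using Suc.prems(2)[OF k x u] by simp
    qed
    have "(\<Sum>k<Suc K. sqrt ((Es k - s)\<^sup>2 - 4)) \<le> (\<Sum>i\<in>{lo..hi}. pos_part (bond_potential a b i - s))"
    proof (rule sum_sqrt_eigenvalues_le[where f = f])
      show "Es k - s > 2" if "k < Suc K" for k by (rule gt[OF that])
      show "Es k - s \<le> Es j - s" if "j \<le> k" "k < Suc K" for j k
        using Suc.prems(1)[OF that] by simp
      show "0 \<le> pos_part (bond_potential a b i - s)" for i by (simp add: pos_part_def)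
    qed (rule form)
    moreover have "(\<Sum>k<Suc K. sqrt ((Es k - s)\<^sup>2 - 4)) = (\<Sum>k<Suc K. shifted_weight (Es k) s)"
      by (intro sum.cong refl) (use gt in \<open>auto simp: shifted_weight_def\<close>)
    ultimately show ?thesis by simp
  qed
qed

section \<open>Beta integrals and the change of variables\<close>

lemma Beta_nonneg: "0 < x \<Longrightarrow> 0 < y \<Longrightarrow> 0 \<le> Beta x (y :: real)"
  unfolding Beta_def by (simp add: Gamma_real_pos less_imp_le)

text \<open>The substitution s = V t extracts the factor V^(p + 1) and leaves the Beta integral with
  exponents p - 1 and 1.\<close>

lemma nn_integral_Beta_pos_part:
  assumes p: "p > 0" and V: "V \<ge> 0"
  shows "(\<integral>\<^sup>+s\<in>{0..}. ennreal (pos_part (V - s) * s powr (p - 1)) \<partial>lborel)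
    = ennreal (Beta p 2 * V powr (p + 1))"
proof (cases "V = 0")
  case True
  have "(\<integral>\<^sup>+s\<in>{0..}. ennreal (pos_part (V - s) * s powr (p - 1)) \<partial>lborel) = (\<integral>\<^sup>+s. 0 \<partial>(lborel :: real measure))"
    by (intro nn_integral_cong) (auto simp: indicator_def True pos_part_def)
  then show ?thesis using True by simp
next
  case False
  then have V: "V > 0" using V by simp
  have [measurable]: "pos_part \<in> borel_measurable borel" unfolding pos_part_def by measurable
  have beta: "((\<lambda>t. t powr (p - 1) * (1 - t) powr (2 - 1)) has_integral Beta p 2) {0..1}"
    using p by (intro has_integral_Beta_real) auto
  have "(\<integral>\<^sup>+s\<in>{0..}. ennreal (pos_part (V - s) * s powr (p - 1)) \<partial>lborel)
    = ennreal \<bar>V\<bar> * (\<integral>\<^sup>+t. ennreal (pos_part (V - (0 + V * t)) * (0 + V * t) powr (p - 1)) * indicator {0..} (0 + V * t) \<partial>lborel)"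
    using V by (intro nn_integral_real_affine) auto
  also have "\<dots> = ennreal V * (\<integral>\<^sup>+t. ennreal (V powr p) *
      (ennreal (t powr (p - 1) * (1 - t) powr (2 - 1)) * indicator {0..1} t) \<partial>lborel)"
  proof -
    have "ennreal (pos_part (V - (0 + V * t)) * (0 + V * t) powr (p - 1)) * indicator {0..} (0 + V * t)
       = ennreal (V powr p) * (ennreal (t powr (p - 1) * (1 - t) powr (2 - 1)) * indicator {0..1} t)" for t
    proof -
      consider "t < 0" | "0 \<le> t" "t \<le> 1" | "t > 1" by linarith
      then show ?thesis
      proof cases
        case 1
        then show ?thesis using V by (simp add: indicator_def zero_le_mult_iff)
      next
        case 2
        have "V - V * t = V * (1 - t)" by (simp add: algebra_simps)
        then have "pos_part (V - (0 + V * t)) = V * (1 - t)" using 2 V by (simp add: pos_part_def)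
        moreover have "(0 + V * t) powr (p - 1) = V powr (p - 1) * t powr (p - 1)"
          using 2 V by (simp add: powr_mult)
        moreover have "V * V powr (p - 1) = V powr p" using V by (simp add: powr_mult_base)
        ultimately have "pos_part (V - (0 + V * t)) * (0 + V * t) powr (p - 1)
            = V powr p * (t powr (p - 1) * (1 - t) powr (2 - 1))"
          using 2 by (simp add: mult_ac)
        then show ?thesis using 2 V by (simp add: ennreal_mult indicator_def)
      next
        case 3
        then show ?thesis using V by (simp add: pos_part_def indicator_def)
      qed
    qed
    then show ?thesis using V by simp
  qed
  also have "\<dots> = ennreal V * (ennreal (V powr p) *
      (\<integral>\<^sup>+t\<in>{0..1}. ennreal (t powr (p - 1) * (1 - t) powr (2 - 1)) \<partial>lborel))"
    by (subst nn_integral_cmult) auto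
  also have "(\<integral>\<^sup>+t\<in>{0..1}. ennreal (t powr (p - 1) * (1 - t) powr (2 - 1)) \<partial>lborel) = ennreal (Beta p 2)"
    by (rule nn_integral_has_integral_lebesgue'[OF _ beta]) auto
  also have "ennreal V * (ennreal (V powr p) * ennreal (Beta p 2)) = ennreal (V * (V powr p * Beta p 2))"
    using V p by (simp add: ennreal_mult' Beta_nonneg)
  also have "V * (V powr p * Beta p 2) = Beta p 2 * V powr (p + 1)"
    using V by (simp add: powr_add)
  finally show ?thesis .
qed

lemma shifted_weight_measurable [measurable]:
  "(\<lambda>s. shifted_weight E s) \<in> borel_measurable borel"
  unfolding shifted_weight_def by measurable

lemma shifted_weight_nonneg: "0 \<le> shifted_weight E s"
proof (cases "E - s > 2")
  case True
  then have "(E - s)\<^sup>2 > 4" using power_strict_mono[of 2 "E - s" 2] by simp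
  then show ?thesis by (simp add: shifted_weight_def)
qed (simp add: shifted_weight_def)

text \<open>This is the substitution t = E - s. For s > E - 2 both sides vanish, the left by the
  indicator and the right by \<open>shifted_weight\<close>.\<close>

lemma nn_integral_reflect_weight:
  assumes "E > 2"
  shows "(\<integral>\<^sup>+t\<in>{2..E}. ennreal ((t\<^sup>2 - 4) powr (1/2) * (E - t) powr q) \<partial>lborel)
    = (\<integral>\<^sup>+s\<in>{0..}. ennreal (shifted_weight E s * s powr q) \<partial>lborel)"
proof -
  have "(\<integral>\<^sup>+t\<in>{2..E}. ennreal ((t\<^sup>2 - 4) powr (1/2) * (E - t) powr q) \<partial>lborel)
    = ennreal \<bar>-1\<bar> * (\<integral>\<^sup>+s. ennreal (((E + (-1) * s)\<^sup>2 - 4) powr (1/2) * (E - (E + (-1) * s)) powr q)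
        * indicator {2..E} (E + (-1) * s) \<partial>lborel)"
    by (rule nn_integral_real_affine) auto
  also have "\<dots> = (\<integral>\<^sup>+s\<in>{0..}. ennreal (shifted_weight E s * s powr q) \<partial>lborel)"
  proof -
    have "ennreal (((E + (-1) * s)\<^sup>2 - 4) powr (1/2) * (E - (E + (-1) * s)) powr q)
        * indicator {2..E} (E + (-1) * s)
      = ennreal (shifted_weight E s * s powr q) * indicator {0..} s" for s
    proof -
      consider "s < 0" | "0 \<le> s" "E - s > 2" | "E - s = 2" "s \<ge> 0" | "E - s < 2" by linarith
      then show ?thesis
      proof cases
        case 2
        then have "(E - s)\<^sup>2 > 4" using power_strict_mono[of 2 "E - s" 2] by simp
        then show ?thesis using 2 by (simp add: shifted_weight_def indicator_def powr_half_sqrt)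
      qed (auto simp: shifted_weight_def indicator_def)
    qed
    then show ?thesis by simp
  qed
  finally show ?thesis .
qed

lemma tendsto_shifted_weight:
  assumes "(E \<longlongrightarrow> l) F"
  shows "((\<lambda>x. shifted_weight (E x) s) \<longlongrightarrow> shifted_weight l s) F"
proof -
  \<comment> \<open>Written with a maximum, the weight is visibly continuous at the threshold y - s
    = 2.\<close>
  have eq: "shifted_weight y s = sqrt ((max (y - s) 2)\<^sup>2 - 4)" for y
    by (auto simp: shifted_weight_def max_def)
  show ?thesis unfolding eq by (intro tendsto_intros assms)
qed

text \<open>Integrating the bound for \<open>J - s\<close> against \<open>s powr (p - 1)\<close> raises the moment.\<close>

lemma integrated_sum_le:
  assumes p: "p > 0" and I: "finite I"
    and le: "\<And>s. s \<ge> 0 \<Longrightarrow> (\<Sum>k<K. shifted_weight (Es k) s) \<le> (\<Sum>i\<in>I. pos_part (V i - s))"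
    and V: "\<And>i. V i \<ge> 0"
  shows "(\<integral>\<^sup>+s\<in>{0..}. ennreal ((\<Sum>k<K. shifted_weight (Es k) s) * s powr (p - 1)) \<partial>lborel)
    \<le> ennreal (Beta p 2) * (\<Sum>i\<in>I. ennreal (V i powr (p + 1)))"
proof -
  have [measurable]: "pos_part \<in> borel_measurable borel" unfolding pos_part_def by measurable
  have "(\<integral>\<^sup>+s\<in>{0..}. ennreal ((\<Sum>k<K. shifted_weight (Es k) s) * s powr (p - 1)) \<partial>lborel)
      \<le> (\<integral>\<^sup>+s. (\<Sum>i\<in>I. ennreal (pos_part (V i - s) * s powr (p - 1)) * indicator {0..} s) \<partial>lborel)"
  proof (rule nn_integral_mono)
    fix s :: real
    show "ennreal ((\<Sum>k<K. shifted_weight (Es k) s) * s powr (p - 1)) * indicator {0..} s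
      \<le> (\<Sum>i\<in>I. ennreal (pos_part (V i - s) * s powr (p - 1)) * indicator {0..} s)"
    proof (cases "s \<ge> 0")
      case True
      have "(\<Sum>k<K. shifted_weight (Es k) s) * s powr (p - 1) \<le> (\<Sum>i\<in>I. pos_part (V i - s) * s powr (p - 1))"
        unfolding sum_distrib_right[symmetric] by (intro mult_right_mono le True) simp
      moreover have "(\<Sum>i\<in>I. ennreal (pos_part (V i - s) * s powr (p - 1)))
          = ennreal (\<Sum>i\<in>I. pos_part (V i - s) * s powr (p - 1))"
        by (rule sum_ennreal) (simp add: pos_part_def)
      ultimately show ?thesis using True by (simp add: ennreal_leI)
    qed simp
  qed
  also have "\<dots> = (\<Sum>i\<in>I. \<integral>\<^sup>+s\<in>{0..}. ennreal (pos_part (V i - s) * s powr (p - 1)) \<partial>lborel)"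
    by (rule nn_integral_sum) measurable
  also have "\<dots> = (\<Sum>i\<in>I. ennreal (Beta p 2) * ennreal (V i powr (p + 1)))"
    using p V by (intro sum.cong refl)
      (simp add: nn_integral_Beta_pos_part ennreal_mult' Beta_nonneg)
  finally show ?thesis unfolding sum_distrib_left .
qed

section \<open>Truncation of square-summable eigenvectors\<close>

definition ell2_ip :: "(int \<Rightarrow> complex) \<Rightarrow> (int \<Rightarrow> complex) \<Rightarrow> complex" where
  "ell2_ip u v = (\<Sum>\<^sub>\<infinity>i. cnj (u i) * v i)"

lemma ell2_ip_summable:
  assumes "u \<in> ell2" "v \<in> ell2"
  shows "(\<lambda>i. cnj (u i) * v i) summable_on UNIV"
proof -
  have "(\<lambda>i. (cmod (u i))\<^sup>2 + (cmod (v i))\<^sup>2) summable_on UNIV"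
    using assms unfolding ell2_def by (intro summable_on_add) auto
  moreover have "norm (cnj (u i) * v i) \<le> (cmod (u i))\<^sup>2 + (cmod (v i))\<^sup>2" for i
  proof -
    have "2 * (cmod (u i) * cmod (v i)) \<le> (cmod (u i))\<^sup>2 + (cmod (v i))\<^sup>2"
      using sum_squares_bound[of "cmod (u i)" "cmod (v i)"] by simp
    moreover have "0 \<le> cmod (u i) * cmod (v i)" by simp
    ultimately show ?thesis unfolding norm_mult complex_mod_cnj by linarith
  qed
  ultimately have "(\<lambda>i. norm (cnj (u i) * v i)) summable_on UNIV"
    by (rule summable_on_comparison_test) auto
  then show ?thesis by (rule abs_summable_summable)
qed

text \<open>Symmetric intervals exhaust the integers, so unordered sums are limits of partial sums
  over the blocks on which the matrix is truncated.\<close>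

lemma filterlim_symmetric_intervals:
  "filterlim (\<lambda>N. {- int N..int N}) (finite_subsets_at_top UNIV) sequentially"
  unfolding filterlim_iff
proof (intro allI impI)
  fix P assume "eventually P (finite_subsets_at_top (UNIV :: int set))"
  then obtain X where X: "finite X" "\<And>Y. finite Y \<Longrightarrow> X \<subseteq> Y \<Longrightarrow> P Y"
    unfolding eventually_finite_subsets_at_top by auto
  have "X \<subseteq> {- int N..int N}" if "N \<ge> nat (\<Sum>i\<in>X. \<bar>i\<bar>)" for N
  proof
    fix i assume "i \<in> X"
    then have "\<bar>i\<bar> \<le> (\<Sum>i\<in>X. \<bar>i\<bar>)" using X(1) by (intro member_le_sum) auto
    then show "i \<in> {- int N..int N}" using that by auto
  qed
  then show "eventually (\<lambda>N. P {- int N..int N}) sequentially"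
    using X(2) by (intro eventually_sequentiallyI[of "nat (\<Sum>i\<in>X. \<bar>i\<bar>)"]) auto
qed

lemma ell2_ip_tendsto:
  assumes "u \<in> ell2" "v \<in> ell2"
  shows "(\<lambda>N. \<Sum>i\<in>{- int N..int N}. cnj (u i) * v i) \<longlonglongrightarrow> ell2_ip u v"
proof -
  have "((\<lambda>i. cnj (u i) * v i) has_sum ell2_ip u v) UNIV"
    unfolding ell2_ip_def by (intro has_sum_infsum ell2_ip_summable assms)
  then show ?thesis
    unfolding has_sum_def using filterlim_symmetric_intervals by (rule filterlim_compose)
qed

lemma ell2_ip_cnj: "ell2_ip v u = cnj (ell2_ip u v)"
  unfolding ell2_ip_def infsum_cnj[symmetric] by (simp add: mult.commute)

text \<open>The square sums over successive symmetric intervals have the same limit, and their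
  difference consists of the two new terms.\<close>

lemma ell2_tendsto_0:
  assumes "u \<in> ell2"
  shows "(\<lambda>N. u (int N)) \<longlonglongrightarrow> 0" "(\<lambda>N. u (- int N)) \<longlonglongrightarrow> 0"
proof -
  have "((\<lambda>i. (cmod (u i))\<^sup>2) has_sum (\<Sum>\<^sub>\<infinity>i. (cmod (u i))\<^sup>2)) UNIV"
    using assms unfolding ell2_def by simp
  then have lim: "(\<lambda>N. \<Sum>i\<in>{- int N..int N}. (cmod (u i))\<^sup>2) \<longlonglongrightarrow> (\<Sum>\<^sub>\<infinity>i. (cmod (u i))\<^sup>2)"
    unfolding has_sum_def using filterlim_symmetric_intervals by (rule filterlim_compose)
  have "(\<lambda>N. (\<Sum>i\<in>{- int (Suc N)..int (Suc N)}. (cmod (u i))\<^sup>2) - (\<Sum>i\<in>{- int N..int N}. (cmod (u i))\<^sup>2))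
      \<longlonglongrightarrow> (\<Sum>\<^sub>\<infinity>i. (cmod (u i))\<^sup>2) - (\<Sum>\<^sub>\<infinity>i. (cmod (u i))\<^sup>2)"
    by (intro tendsto_diff LIMSEQ_Suc lim)
  moreover have "(\<Sum>i\<in>{- int (Suc N)..int (Suc N)}. (cmod (u i))\<^sup>2) - (\<Sum>i\<in>{- int N..int N}. (cmod (u i))\<^sup>2)
      = (cmod (u (int (Suc N))))\<^sup>2 + (cmod (u (- int (Suc N))))\<^sup>2" for N
  proof -
    have "{- int (Suc N)..int (Suc N)} = insert (int (Suc N)) (insert (- int (Suc N)) {- int N..int N})"
      by auto
    then show ?thesis by simp
  qed
  ultimately have 0: "(\<lambda>N. (cmod (u (int (Suc N))))\<^sup>2 + (cmod (u (- int (Suc N))))\<^sup>2) \<longlonglongrightarrow> 0" by simp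
  have "(\<lambda>N. (cmod (u (int (Suc N))))\<^sup>2) \<longlonglongrightarrow> 0"
    by (rule tendsto_sandwich[OF _ _ tendsto_const 0]) auto
  then have "(\<lambda>N. u (int (Suc N))) \<longlonglongrightarrow> 0"
    by (simp add: tendsto_norm_zero_iff)
  then show "(\<lambda>N. u (int N)) \<longlonglongrightarrow> 0"
    by (rule LIMSEQ_imp_Suc)
  have "(\<lambda>N. (cmod (u (- int (Suc N))))\<^sup>2) \<longlonglongrightarrow> 0"
    by (rule tendsto_sandwich[OF _ _ tendsto_const 0]) auto
  then have "(\<lambda>N. u (- int (Suc N))) \<longlonglongrightarrow> 0"
    by (simp add: tendsto_norm_zero_iff)
  then show "(\<lambda>N. u (- int N)) \<longlonglongrightarrow> 0"
    by (rule LIMSEQ_imp_Suc)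
qed

text \<open>Inside the block the cut matrix agrees with J except at the two end sites, where a
  neighbour is missing. The missing terms tend to 0 because \<open>u\<close> and \<open>v\<close> do
  and the bonds converge.\<close>

lemma cut_jacobi_form_tendsto:
  assumes a: "(a \<longlongrightarrow> 1) at_top" "(a \<longlongrightarrow> 1) at_bot"
    and u: "u \<in> ell2" and v: "v \<in> ell2" "jacobi a b v = seq_scale (of_real E) v"
  shows "(\<lambda>N. \<Sum>i\<in>{- int N..int N}. cnj (u i) * jacobi (cut_bonds (- int N) (int N) a) b v i)
    \<longlonglongrightarrow> of_real E * ell2_ip u v"
proof -
  have eq: "(\<Sum>i\<in>{- int N..int N}. cnj (u i) * jacobi (cut_bonds (- int N) (int N) a) b v i)
    = of_real E * (\<Sum>i\<in>{- int N..int N}. cnj (u i) * v i)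
      - cnj (u (- int N)) * (of_real (a (- int (Suc N))) * v (- int (Suc N)))
      - cnj (u (int N)) * (of_real (a (int N)) * v (int (Suc N)))" for N
  proof -
    have jac: "jacobi (cut_bonds (- int N) (int N) a) b v i = of_real E * v i
      - (if i = - int N then of_real (a (- int (Suc N))) * v (- int (Suc N)) else 0)
      - (if i = int N then of_real (a (int N)) * v (int (Suc N)) else 0)" if "i \<in> {- int N..int N}" for i
    proof -
      have "jacobi a b v i = of_real E * v i" using v(2) by (simp add: seq_scale_def)
      moreover have "of_real (cut_bonds (- int N) (int N) a (i - 1)) * v (i - 1) = of_real (a (i - 1)) * v (i - 1)
          - (if i = - int N then of_real (a (- int (Suc N))) * v (- int (Suc N)) else 0)"
      proof (cases "i = - int N")
        case True
        then have "i - 1 = - int (Suc N)" by simp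
        then show ?thesis using True by (simp add: cut_bonds_def minus_diff_commute)
      next
        case False
        then show ?thesis using that by (simp add: cut_bonds_def)
      qed
      moreover have "of_real (cut_bonds (- int N) (int N) a i) * v (i + 1) = of_real (a i) * v (i + 1)
          - (if i = int N then of_real (a (int N)) * v (int (Suc N)) else 0)"
      proof (cases "i = int N")
        case True
        then have "i + 1 = int (Suc N)" by simp
        then show ?thesis using True by (simp add: cut_bonds_def add.commute)
      next
        case False
        then show ?thesis using that by (simp add: cut_bonds_def)
      qed
      ultimately show ?thesis unfolding jacobi_def by (simp add: algebra_simps)
    qed
    have "(\<Sum>i\<in>{- int N..int N}. cnj (u i) * jacobi (cut_bonds (- int N) (int N) a) b v i)
      = (\<Sum>i\<in>{- int N..int N}. of_real E * (cnj (u i) * v i)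
        - (if i = - int N then cnj (u (- int N)) * (of_real (a (- int (Suc N))) * v (- int (Suc N))) else 0)
        - (if i = int N then cnj (u (int N)) * (of_real (a (int N)) * v (int (Suc N))) else 0))"
      by (intro sum.cong refl, subst jac) (auto simp: algebra_simps)
    then show ?thesis by (simp add: sum_subtractf sum_distrib_left)
  qed
  have a': "(\<lambda>N. a (int N)) \<longlonglongrightarrow> 1"
    using a(1) filterlim_int_sequentially by (rule filterlim_compose)
  have "filterlim (\<lambda>N. - int N) at_bot sequentially"
    unfolding filterlim_at_bot eventually_sequentially
  proof
    fix Z :: int
    show "\<exists>M. \<forall>N\<ge>M. - int N \<le> Z" by (intro exI[of _ "nat (- Z)"]) auto
  qed
  with a(2) have a'': "(\<lambda>N. a (- int N)) \<longlonglongrightarrow> 1" by (rule filterlim_compose)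
  have "(\<lambda>N. of_real E * (\<Sum>i\<in>{- int N..int N}. cnj (u i) * v i)
      - cnj (u (- int N)) * (of_real (a (- int (Suc N))) * v (- int (Suc N)))
      - cnj (u (int N)) * (of_real (a (int N)) * v (int (Suc N))))
    \<longlonglongrightarrow> of_real E * ell2_ip u v - cnj 0 * (of_real 1 * 0) - cnj 0 * (of_real 1 * 0)"
    by (intro tendsto_diff tendsto_mult tendsto_const tendsto_of_real tendsto_cnj
        ell2_ip_tendsto[OF u v(1)] ell2_tendsto_0[OF u] a'
        LIMSEQ_Suc[OF a''] LIMSEQ_Suc[OF ell2_tendsto_0(1)[OF v(1)]] LIMSEQ_Suc[OF ell2_tendsto_0(2)[OF v(1)]])
  then show ?thesis unfolding eq by simp
qed

lemma cut_jacobi_hermitian: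
  "(\<Sum>i\<in>{lo..hi}. cnj (u i) * jacobi (cut_bonds lo hi a) b v i)
    = cnj (\<Sum>i\<in>{lo..hi}. cnj (v i) * jacobi (cut_bonds lo hi a) b u i)"
proof -
  define \<delta> where "\<delta> = cut_bonds lo hi a"
  have outside: "i < lo \<or> hi \<le> i \<Longrightarrow> \<delta> i = 0" for i by (auto simp: \<delta>_def cut_bonds_def)
  note shift = sum_bond_shift[of lo hi \<delta>, OF outside]
  have form: "(\<Sum>i\<in>{lo..hi}. cnj (x i) * jacobi \<delta> b y i) = (\<Sum>i\<in>{lo..hi}. of_real (b i) * (cnj (x i) * y i))
      + (\<Sum>i\<in>{lo..hi}. \<delta> i *\<^sub>R (cnj (x (i + 1)) * y i)) + (\<Sum>i\<in>{lo..hi}. \<delta> i *\<^sub>R (cnj (x i) * y (i + 1)))" for x y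
  proof -
    have "(\<Sum>i\<in>{lo..hi}. cnj (x i) * jacobi \<delta> b y i) = (\<Sum>i\<in>{lo..hi}. of_real (b i) * (cnj (x i) * y i))
      + (\<Sum>i\<in>{lo..hi}. \<delta> (i - 1) *\<^sub>R (cnj (x (i - 1 + 1)) * y (i - 1))) + (\<Sum>i\<in>{lo..hi}. \<delta> i *\<^sub>R (cnj (x i) * y (i + 1)))"
      unfolding jacobi_def sum.distrib[symmetric]
      by (intro sum.cong refl) (simp add: scaleR_conv_of_real algebra_simps)
    also have "(\<Sum>i\<in>{lo..hi}. \<delta> (i - 1) *\<^sub>R (cnj (x (i - 1 + 1)) * y (i - 1)))
        = (\<Sum>i\<in>{lo..hi}. \<delta> i *\<^sub>R (cnj (x (i + 1)) * y i))"
      by (rule shift)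
    finally show ?thesis .
  qed
  show ?thesis unfolding form \<delta>_def[symmetric]
    by (simp add: scaleR_conv_of_real mult.commute add.commute add.left_commute)
qed

text \<open>The cut form is Hermitian, and its limit is \<open>E'\<close> or \<open>E\<close> times
  the inner product, according to which of the vectors the matrix is applied to. Uniqueness of
  limits replaces an appeal to self-adjointness of J.\<close>

lemma eigenvectors_orthogonal:
  assumes a: "(a \<longlongrightarrow> 1) at_top" "(a \<longlongrightarrow> 1) at_bot"
    and u: "u \<in> ell2" "jacobi a b u = seq_scale (of_real E) u"
    and v: "v \<in> ell2" "jacobi a b v = seq_scale (of_real E') v" and neq: "E \<noteq> E'"
  shows "ell2_ip u v = 0"
proof -
  note ip = ell2_ip_cnj[of u v]
  have 1: "(\<lambda>N. \<Sum>i\<in>{- int N..int N}. cnj (u i) * jacobi (cut_bonds (- int N) (int N) a) b v i)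
    \<longlonglongrightarrow> of_real E' * ell2_ip u v"
    by (rule cut_jacobi_form_tendsto[OF a u(1) v])
  have "(\<lambda>N. cnj (\<Sum>i\<in>{- int N..int N}. cnj (v i) * jacobi (cut_bonds (- int N) (int N) a) b u i))
    \<longlonglongrightarrow> cnj (of_real E * ell2_ip v u)"
    by (intro tendsto_cnj cut_jacobi_form_tendsto[OF a v(1) u])
  then have "(\<lambda>N. \<Sum>i\<in>{- int N..int N}. cnj (u i) * jacobi (cut_bonds (- int N) (int N) a) b v i)
    \<longlonglongrightarrow> of_real E * ell2_ip u v"
    unfolding cut_jacobi_hermitian[symmetric] ip by simp
  with 1 have "complex_of_real E' * ell2_ip u v = of_real E * ell2_ip u v" by (rule LIMSEQ_unique)
  then show ?thesis using neq by simp
qed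

text \<open>Only finitely many entries converge, so one threshold for \<open>N\<close> brings the
  whole matrix within \<epsilon> / 2 of its diagonal limit in operator norm, uniformly in
  \<open>x\<close>.\<close>

lemma eventually_form_pos:
  fixes T :: "nat \<Rightarrow> nat \<Rightarrow> nat \<Rightarrow> complex"
  assumes lim: "\<And>l j. l \<le> k \<Longrightarrow> j \<le> k \<Longrightarrow> (\<lambda>N. T N l j) \<longlonglongrightarrow> (if l = j then of_real (\<tau> j) else 0)"
    and \<tau>: "\<And>j. j \<le> k \<Longrightarrow> \<epsilon> \<le> \<tau> j" and \<epsilon>: "\<epsilon> > 0"
  shows "eventually (\<lambda>N. \<forall>x. (\<exists>j\<le>k. x j \<noteq> 0) \<longrightarrow> 0 < Re (\<Sum>l\<le>k. \<Sum>j\<le>k. cnj (x l) * x j * T N l j)) sequentially"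
proof -
  \<comment> \<open>The error form is at most (k + 1) \<eta> times the square norm of
    \<open>x\<close>, which this choice makes half of the lower bound \<epsilon>.\<close>
  define \<eta> where "\<eta> = \<epsilon> / (2 * real (Suc k))"
  have \<eta>: "\<eta> > 0" using \<epsilon> by (simp add: \<eta>_def)
  define D where "D l j = (if l = j then complex_of_real (\<tau> j) else 0)" for l j
  have "eventually (\<lambda>N. \<forall>l\<in>{..k}. \<forall>j\<in>{..k}. dist (T N l j) (D l j) < \<eta>) sequentially"
    unfolding eventually_ball_finite_distrib[OF finite_atMost] D_def
    using tendstoD[OF lim \<eta>] by auto
  then show ?thesis
  proof (eventually_elim, intro allI impI)
    fix N and x :: "nat \<Rightarrow> complex"
    assume near: "\<forall>l\<in>{..k}. \<forall>j\<in>{..k}. dist (T N l j) (D l j) < \<eta>" and x: "\<exists>j\<le>k. x j \<noteq> 0"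
    define S where "S = (\<Sum>j\<le>k. (cmod (x j))\<^sup>2)"
    have S: "S > 0"
    proof -
      obtain j where "j \<le> k" "x j \<noteq> 0" using x by auto
      then show ?thesis unfolding S_def by (intro sum_pos2[of _ j]) auto
    qed
    have "(\<Sum>l\<le>k. \<Sum>j\<le>k. cnj (x l) * x j * D l j) = (\<Sum>j\<le>k. of_real (\<tau> j * (cmod (x j))\<^sup>2))"
    proof (rule sum.cong[OF refl])
      fix l assume "l \<in> {..k}"
      then have "(\<Sum>j\<le>k. cnj (x l) * x j * D l j) = cnj (x l) * x l * of_real (\<tau> l)"
        by (simp add: D_def if_distrib cong: if_cong)
      then show "(\<Sum>j\<le>k. cnj (x l) * x j * D l j) = of_real (\<tau> l * (cmod (x l))\<^sup>2)"
        by (simp only: of_real_mult complex_norm_square) (simp add: mult_ac)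
    qed
    then have "Re (\<Sum>l\<le>k. \<Sum>j\<le>k. cnj (x l) * x j * D l j) = (\<Sum>j\<le>k. \<tau> j * (cmod (x j))\<^sup>2)"
      by (simp flip: of_real_sum)
    moreover have "\<epsilon> * S \<le> (\<Sum>j\<le>k. \<tau> j * (cmod (x j))\<^sup>2)"
      unfolding S_def sum_distrib_left by (intro sum_mono mult_right_mono \<tau>) auto
    moreover have "cmod (\<Sum>l\<le>k. \<Sum>j\<le>k. cnj (x l) * x j * (T N l j - D l j)) \<le> \<epsilon> / 2 * S"
    proof -
      have "cmod (cnj (x l) * x j * (T N l j - D l j)) \<le> ((cmod (x l))\<^sup>2 + (cmod (x j))\<^sup>2) / 2 * \<eta>"
        if "l \<le> k" "j \<le> k" for l j
      proof -
        have "cmod (T N l j - D l j) \<le> \<eta>" using near that by (auto simp: dist_norm less_imp_le)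
        moreover have "cmod (x l) * cmod (x j) \<le> ((cmod (x l))\<^sup>2 + (cmod (x j))\<^sup>2) / 2"
          using sum_squares_bound[of "cmod (x l)" "cmod (x j)"] by simp
        ultimately show ?thesis unfolding norm_mult complex_mod_cnj by (intro mult_mono) auto
      qed
      then have "cmod (\<Sum>l\<le>k. \<Sum>j\<le>k. cnj (x l) * x j * (T N l j - D l j))
          \<le> (\<Sum>l\<le>k. \<Sum>j\<le>k. ((cmod (x l))\<^sup>2 + (cmod (x j))\<^sup>2) / 2 * \<eta>)"
        by (intro order_trans[OF norm_sum] sum_mono) auto
      also have "\<dots> = real (Suc k) * S * \<eta>"
        unfolding S_def by (simp add: sum.distrib add_divide_distrib distrib_right
            sum_distrib_left[symmetric] sum_distrib_right[symmetric] sum_divide_distrib[symmetric])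
      also have "\<dots> = \<epsilon> / 2 * S" unfolding \<eta>_def by (simp add: field_simps)
      finally show ?thesis .
    qed
    then have "- (\<epsilon> / 2 * S) \<le> Re (\<Sum>l\<le>k. \<Sum>j\<le>k. cnj (x l) * x j * (T N l j - D l j))"
      using abs_Re_le_cmod[of "\<Sum>l\<le>k. \<Sum>j\<le>k. cnj (x l) * x j * (T N l j - D l j)"] by linarith
    moreover have "(\<Sum>l\<le>k. \<Sum>j\<le>k. cnj (x l) * x j * T N l j)
        = (\<Sum>l\<le>k. \<Sum>j\<le>k. cnj (x l) * x j * D l j) + (\<Sum>l\<le>k. \<Sum>j\<le>k. cnj (x l) * x j * (T N l j - D l j))"
      unfolding sum.distrib[symmetric] by (intro sum.cong refl) (simp add: algebra_simps)
    moreover have "\<epsilon> * S - \<epsilon> / 2 * S > 0" using S \<epsilon> by simp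
    ultimately show "0 < Re (\<Sum>l\<le>k. \<Sum>j\<le>k. cnj (x l) * x j * T N l j)"
      by (simp only: plus_complex.sel)
  qed
qed

lemma jacobi_sum:
  "jacobi a b (\<lambda>i. \<Sum>j\<in>S. x j * U j i) i = (\<Sum>j\<in>S. x j * jacobi a b (U j) i)"
  unfolding jacobi_def by (simp add: sum_distrib_left sum.distrib algebra_simps)

lemma sesquilinear_expand:
  "(\<Sum>l\<in>S. \<Sum>j\<in>S. cnj (x l) * x j * (\<Sum>i\<in>I. cnj (U l i) * V j i))
    = (\<Sum>i\<in>I. cnj (\<Sum>l\<in>S. x l * U l i) * (\<Sum>j\<in>S. x j * V j i))"
proof -
  have "(\<Sum>i\<in>I. cnj (\<Sum>l\<in>S. x l * U l i) * (\<Sum>j\<in>S. x j * V j i))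
    = (\<Sum>i\<in>I. \<Sum>l\<in>S. \<Sum>j\<in>S. cnj (x l) * x j * (cnj (U l i) * V j i))"
    unfolding cnj_sum sum_product by (intro sum.cong refl) (simp add: mult_ac)
  also have "\<dots> = (\<Sum>l\<in>S. \<Sum>i\<in>I. \<Sum>j\<in>S. cnj (x l) * x j * (cnj (U l i) * V j i))"
    by (rule sum.swap)
  also have "\<dots> = (\<Sum>l\<in>S. \<Sum>j\<in>S. \<Sum>i\<in>I. cnj (x l) * x j * (cnj (U l i) * V j i))"
    by (intro sum.cong refl sum.swap)
  finally show ?thesis by (simp add: sum_distrib_left)
qed

text \<open>On growing blocks the Gram matrix of the eigenvectors tends to the identity and the
  matrix of the cut form to the diagonal matrix of the \<open>Es j\<close>. Since these decrease,
  the cut form minus \<open>Es k - \<epsilon>\<close> times the Gram matrix tends to a diagonal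
  matrix with entries at least \<epsilon>. The loss \<epsilon> buys positivity on a finite
  block.\<close>

lemma truncated_eigenvectors:
  fixes Es :: "nat \<Rightarrow> real"
  assumes a: "(a \<longlongrightarrow> 1) at_top" "(a \<longlongrightarrow> 1) at_bot"
    and E: "\<And>j k. j \<le> k \<Longrightarrow> k < K \<Longrightarrow> Es k \<le> Es j"
    and U: "\<And>k. k < K \<Longrightarrow> U k \<in> ell2" "\<And>k. k < K \<Longrightarrow> jacobi a b (U k) = seq_scale (of_real (Es k)) (U k)"
    and ortho: "\<And>j k. j < K \<Longrightarrow> k < K \<Longrightarrow> ell2_ip (U j) (U k) = (if j = k then 1 else 0)"
    and \<epsilon>: "\<epsilon> > 0"
  shows "\<exists>N. \<forall>k<K. \<forall>x u. (\<exists>j\<le>k. x j \<noteq> 0) \<longrightarrow> u = (\<lambda>i. \<Sum>j\<le>k. x j * U j i) \<longrightarrow>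
      0 < (\<Sum>i\<in>{- int N..int N}. (cmod (u i))\<^sup>2) \<and>
      (Es k - \<epsilon>) * (\<Sum>i\<in>{- int N..int N}. (cmod (u i))\<^sup>2)
        \<le> (\<Sum>i\<in>{- int N..int N}. jacobi (cut_bonds (- int N) (int N) a) b u i \<bullet> u i)"
    (is "\<exists>N. \<forall>k<K. ?P k N")
proof -
  define T where "T N l j = (\<Sum>i\<in>{- int N..int N}. cnj (U l i) * U j i)" for N l j
  define S where "S N l j = (\<Sum>i\<in>{- int N..int N}. cnj (U l i) * jacobi (cut_bonds (- int N) (int N) a) b (U j) i)" for N l j
  have T: "(\<lambda>N. T N l j) \<longlonglongrightarrow> (if l = j then of_real 1 else 0)" if "l < K" "j < K" for l j
    using ell2_ip_tendsto[OF U(1)[OF that(1)] U(1)[OF that(2)]] ortho[OF that] unfolding T_def by auto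
  have S: "(\<lambda>N. S N l j) \<longlonglongrightarrow> (if l = j then of_real (Es j) else 0)" if "l < K" "j < K" for l j
    using cut_jacobi_form_tendsto[OF a U(1)[OF that(1)] U(1)[OF that(2)] U(2)[OF that(2)]] ortho[OF that]
    unfolding S_def by (auto split: if_splits)
  have "eventually (?P k) sequentially" if k: "k < K" for k
  proof -
    have ev1: "eventually (\<lambda>N. \<forall>x. (\<exists>j\<le>k. x j \<noteq> 0) \<longrightarrow>
        0 < Re (\<Sum>l\<le>k. \<Sum>j\<le>k. cnj (x l) * x j * T N l j)) sequentially"
      by (rule eventually_form_pos[where \<tau> = "\<lambda>_. 1" and \<epsilon> = 1]) (use T k in auto)
    have "(\<lambda>N. S N l j - of_real (Es k - \<epsilon>) * T N l j) \<longlonglongrightarrow> (if l = j then of_real (Es j - (Es k - \<epsilon>)) else 0)"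
      if "l \<le> k" "j \<le> k" for l j
    proof -
      have "(\<lambda>N. S N l j - of_real (Es k - \<epsilon>) * T N l j)
          \<longlonglongrightarrow> (if l = j then of_real (Es j) else 0) - of_real (Es k - \<epsilon>) * (if l = j then of_real 1 else 0)"
        using that k by (intro tendsto_intros S T) auto
      moreover have "(if l = j then of_real (Es j) else 0) - of_real (Es k - \<epsilon>) * (if l = j then of_real 1 else 0)
          = (if l = j then complex_of_real (Es j - (Es k - \<epsilon>)) else 0)" by simp
      ultimately show ?thesis by simp
    qed
    then have ev2: "eventually (\<lambda>N. \<forall>x. (\<exists>j\<le>k. x j \<noteq> 0) \<longrightarrow>
        0 < Re (\<Sum>l\<le>k. \<Sum>j\<le>k. cnj (x l) * x j * (S N l j - of_real (Es k - \<epsilon>) * T N l j))) sequentially"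
      by (rule eventually_form_pos[where \<epsilon> = \<epsilon>]) (use E k \<epsilon> in auto)
    from ev1 ev2 show ?thesis
    proof (eventually_elim, intro allI impI)
      fix N x u
      assume 1: "\<forall>x. (\<exists>j\<le>k. x j \<noteq> 0) \<longrightarrow> 0 < Re (\<Sum>l\<le>k. \<Sum>j\<le>k. cnj (x l) * x j * T N l j)"
        and 2: "\<forall>x. (\<exists>j\<le>k. x j \<noteq> 0) \<longrightarrow>
          0 < Re (\<Sum>l\<le>k. \<Sum>j\<le>k. cnj (x l) * x j * (S N l j - of_real (Es k - \<epsilon>) * T N l j))"
        and x: "\<exists>j\<le>k. x j \<noteq> 0" and u: "u = (\<lambda>i. \<Sum>j\<le>k. x j * U j i)"
      have Tu: "Re (\<Sum>l\<le>k. \<Sum>j\<le>k. cnj (x l) * x j * T N l j) = (\<Sum>i\<in>{- int N..int N}. (cmod (u i))\<^sup>2)"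
      proof -
        have "(\<Sum>l\<le>k. \<Sum>j\<le>k. cnj (x l) * x j * T N l j) = (\<Sum>i\<in>{- int N..int N}. cnj (u i) * u i)"
          unfolding T_def sesquilinear_expand u ..
        then show ?thesis
          by (simp add: power2_norm_eq_inner inner_complex_def)
      qed
      have Su: "Re (\<Sum>l\<le>k. \<Sum>j\<le>k. cnj (x l) * x j * S N l j)
          = (\<Sum>i\<in>{- int N..int N}. jacobi (cut_bonds (- int N) (int N) a) b u i \<bullet> u i)"
      proof -
        have "(\<Sum>l\<le>k. \<Sum>j\<le>k. cnj (x l) * x j * S N l j)
            = (\<Sum>i\<in>{- int N..int N}. cnj (u i) * jacobi (cut_bonds (- int N) (int N) a) b u i)"
          unfolding S_def sesquilinear_expand u jacobi_sum ..
        then show ?thesis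
          by (simp add: inner_complex_def mult.commute)
      qed
      have "(\<Sum>l\<le>k. \<Sum>j\<le>k. cnj (x l) * x j * (S N l j - of_real (Es k - \<epsilon>) * T N l j))
        = (\<Sum>l\<le>k. \<Sum>j\<le>k. cnj (x l) * x j * S N l j)
          - of_real (Es k - \<epsilon>) * (\<Sum>l\<le>k. \<Sum>j\<le>k. cnj (x l) * x j * T N l j)"
        unfolding sum_distrib_left sum_subtractf[symmetric]
        by (intro sum.cong refl) (simp add: algebra_simps)
      then have "0 < Re (\<Sum>l\<le>k. \<Sum>j\<le>k. cnj (x l) * x j * S N l j)
          - (Es k - \<epsilon>) * Re (\<Sum>l\<le>k. \<Sum>j\<le>k. cnj (x l) * x j * T N l j)"
        using 2 x by (metis (no_types, lifting) minus_complex.sel(1) Re_complex_of_real Im_complex_of_real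
            times_complex.sel(1) mult_zero_left diff_zero)
      then show "0 < (\<Sum>i\<in>{- int N..int N}. (cmod (u i))\<^sup>2) \<and>
          (Es k - \<epsilon>) * (\<Sum>i\<in>{- int N..int N}. (cmod (u i))\<^sup>2)
          \<le> (\<Sum>i\<in>{- int N..int N}. jacobi (cut_bonds (- int N) (int N) a) b u i \<bullet> u i)"
        using 1 x unfolding Tu[symmetric] Su[symmetric] by auto
    qed
  qed
  then have "eventually (\<lambda>N. \<forall>k\<in>{..<K}. ?P k N) sequentially"
    by (subst eventually_ball_finite_distrib) auto
  then obtain N where "\<forall>k\<in>{..<K}. ?P k N"
    using eventually_happens'[OF sequentially_bot] by blast
  then show ?thesis by (intro exI[of _ N]) auto
qed

section \<open>Integrated bounds for finite orthonormal systems of eigenvectors\<close>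

lemma ordered_system_bound:
  fixes Es :: "nat \<Rightarrow> real"
  assumes a: "(a \<longlongrightarrow> 1) at_top" "(a \<longlongrightarrow> 1) at_bot" "\<And>i. 0 \<le> a i" and p: "p > 0"
    and E: "\<And>j k. j \<le> k \<Longrightarrow> k < K \<Longrightarrow> Es k \<le> Es j" "\<And>k. k < K \<Longrightarrow> Es k > 2"
    and U: "\<And>k. k < K \<Longrightarrow> U k \<in> ell2" "\<And>k. k < K \<Longrightarrow> jacobi a b (U k) = seq_scale (of_real (Es k)) (U k)"
    and ortho: "\<And>j k. j < K \<Longrightarrow> k < K \<Longrightarrow> ell2_ip (U j) (U k) = (if j = k then 1 else 0)"
  shows "(\<Sum>k<K. \<integral>\<^sup>+t\<in>{2..Es k}. ennreal ((t\<^sup>2 - 4) powr (1/2) * (Es k - t) powr (p - 1)) \<partial>lborel)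
    \<le> ennreal (Beta p 2) * (\<Sum>\<^sub>\<infinity>n. ennreal (bond_potential a b n powr (p + 1)))"
proof -
  define B where "B = ennreal (Beta p 2) * (\<Sum>\<^sub>\<infinity>n. ennreal (bond_potential a b n powr (p + 1)))"
  \<comment> \<open>The energies are lowered by 1 / (m + 1), the loss of the truncation; it is
    removed at the end by Fatou's lemma.\<close>
  define g where "g m s = (\<Sum>k<K. shifted_weight (Es k - 1 / real (Suc m)) s) * s powr (p - 1)" for m s
  have V: "bond_potential a b i \<ge> 0" for i by (simp add: bond_potential_def pos_part_def)
  have bound: "(\<integral>\<^sup>+s\<in>{0..}. ennreal (g m s) \<partial>lborel) \<le> B" for m
  proof -
    define \<epsilon> where "\<epsilon> = 1 / real (Suc m)"
    have "\<epsilon> > 0" by (simp add: \<epsilon>_def)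
    from truncated_eigenvectors[of a K Es U b, OF a(1,2) E(1) U ortho this] obtain N where
      N: "\<And>k x u. k < K \<Longrightarrow> \<exists>j\<le>k. x j \<noteq> 0 \<Longrightarrow> u = (\<lambda>i. \<Sum>j\<le>k. x j * U j i) \<Longrightarrow>
        0 < (\<Sum>i\<in>{- int N..int N}. (cmod (u i))\<^sup>2) \<and>
        (Es k - \<epsilon>) * (\<Sum>i\<in>{- int N..int N}. (cmod (u i))\<^sup>2)
          \<le> (\<Sum>i\<in>{- int N..int N}. jacobi (cut_bonds (- int N) (int N) a) b u i \<bullet> u i)"
      by blast
    have "(\<Sum>k<K. shifted_weight (Es k - \<epsilon>) s) \<le> (\<Sum>i\<in>{- int N..int N}. pos_part (bond_potential a b i - s))" for s
      by (rule sum_shifted_weight_le[where f = U and Es = "\<lambda>k. Es k - \<epsilon>"]) (use a(3) E(1) N in auto)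
    then have "(\<integral>\<^sup>+s\<in>{0..}. ennreal (g m s) \<partial>lborel)
        \<le> ennreal (Beta p 2) * (\<Sum>i\<in>{- int N..int N}. ennreal (bond_potential a b i powr (p + 1)))"
      unfolding g_def \<epsilon>_def[symmetric] by (intro integrated_sum_le p V) auto
    \<comment> \<open>The block depends on \<open>m\<close>, so its sum is replaced by the sum over
      all integers, the same bound for every \<open>m\<close>.\<close>
    also have "\<dots> \<le> B"
      unfolding B_def
      by (intro mult_left_mono) (auto simp: nonneg_infsum_complete intro!: SUP_upper)
    finally show ?thesis .
  qed
  have meas [measurable]: "g m \<in> borel_measurable borel" for m unfolding g_def by measurable
  have "(\<Sum>k<K. \<integral>\<^sup>+t\<in>{2..Es k}. ennreal ((t\<^sup>2 - 4) powr (1/2) * (Es k - t) powr (p - 1)) \<partial>lborel)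
    = (\<Sum>k<K. \<integral>\<^sup>+s\<in>{0..}. ennreal (shifted_weight (Es k) s * s powr (p - 1)) \<partial>lborel)"
    by (intro sum.cong refl nn_integral_reflect_weight E(2)) auto
  also have "\<dots> = (\<integral>\<^sup>+s. (\<Sum>k<K. ennreal (shifted_weight (Es k) s * s powr (p - 1)) * indicator {0..} s) \<partial>lborel)"
    by (rule nn_integral_sum[symmetric]) measurable
  also have "\<dots> = (\<integral>\<^sup>+s. liminf (\<lambda>m. ennreal (g m s) * indicator {0..} s) \<partial>lborel)"
  proof (rule nn_integral_cong)
    fix s :: real
    have "(\<lambda>m. Es k - 1 / real (Suc m)) \<longlonglongrightarrow> Es k - 0" for k
      by (intro tendsto_diff tendsto_const LIMSEQ_Suc[OF lim_1_over_n])
    then have "(\<lambda>m. g m s) \<longlonglongrightarrow> (\<Sum>k<K. shifted_weight (Es k) s) * s powr (p - 1)"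
      unfolding g_def by (intro tendsto_mult tendsto_const tendsto_sum tendsto_shifted_weight) simp
    then have "(\<lambda>m. ennreal (g m s)) \<longlonglongrightarrow> ennreal ((\<Sum>k<K. shifted_weight (Es k) s) * s powr (p - 1))"
      by (rule tendsto_ennrealI)
    moreover have "ennreal ((\<Sum>k<K. shifted_weight (Es k) s) * s powr (p - 1))
        = (\<Sum>k<K. ennreal (shifted_weight (Es k) s * s powr (p - 1)))"
      unfolding sum_distrib_right by (rule sum_ennreal[symmetric])
        (simp add: shifted_weight_nonneg)
    ultimately have "(\<lambda>m. ennreal (g m s) * indicator {0..} s)
        \<longlonglongrightarrow> (\<Sum>k<K. ennreal (shifted_weight (Es k) s * s powr (p - 1)) * indicator {0..} s)"
      by (cases "s \<ge> 0") auto
    then show "(\<Sum>k<K. ennreal (shifted_weight (Es k) s * s powr (p - 1)) * indicator {0..} s)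
        = liminf (\<lambda>m. ennreal (g m s) * indicator {0..} s)"
      by (intro lim_imp_Liminf[symmetric]) auto
  qed
  also have "\<dots> \<le> liminf (\<lambda>m. \<integral>\<^sup>+s\<in>{0..}. ennreal (g m s) \<partial>lborel)"
    by (intro nn_integral_liminf) measurable
  also have "\<dots> \<le> B" by (intro Liminf_le) (auto simp: bound)
  finally show ?thesis unfolding B_def .
qed

lemma eigen_system_bound:
  fixes E :: "'i \<Rightarrow> real"
  assumes a: "(a \<longlongrightarrow> 1) at_top" "(a \<longlongrightarrow> 1) at_bot" "\<And>i. 0 \<le> a i" and p: "p > 0"
    and F: "finite F" and E: "\<And>x. x \<in> F \<Longrightarrow> E x > 2"
    and U: "\<And>x. x \<in> F \<Longrightarrow> U x \<in> ell2" "\<And>x. x \<in> F \<Longrightarrow> jacobi a b (U x) = seq_scale (of_real (E x)) (U x)"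
    and ortho: "\<And>x y. x \<in> F \<Longrightarrow> y \<in> F \<Longrightarrow> ell2_ip (U x) (U y) = (if x = y then 1 else 0)"
  shows "(\<Sum>x\<in>F. \<integral>\<^sup>+t\<in>{2..E x}. ennreal ((t\<^sup>2 - 4) powr (1/2) * (E x - t) powr (p - 1)) \<partial>lborel)
    \<le> ennreal (Beta p 2) * (\<Sum>\<^sub>\<infinity>n. ennreal (bond_potential a b n powr (p + 1)))"
proof -
  obtain ys where ys: "distinct ys" "set ys = F" using finite_distinct_list[OF F] by auto
  \<comment> \<open>The frame argument needs the energies in decreasing order, repetitions
    allowed.\<close>
  define xs where "xs = sort_key (\<lambda>x. - E x) ys"
  have xs: "distinct xs" "set xs = F" "sorted (map (\<lambda>x. - E x) xs)"
    using ys unfolding xs_def by simp_all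
  have mem: "xs ! k \<in> F" if "k < length xs" for k using that xs(2) by auto
  have "(\<Sum>x\<in>F. \<integral>\<^sup>+t\<in>{2..E x}. ennreal ((t\<^sup>2 - 4) powr (1/2) * (E x - t) powr (p - 1)) \<partial>lborel)
    = (\<Sum>k<length xs. \<integral>\<^sup>+t\<in>{2..E (xs ! k)}. ennreal ((t\<^sup>2 - 4) powr (1/2) * (E (xs ! k) - t) powr (p - 1)) \<partial>lborel)"
    by (rule sum.reindex_bij_betw[symmetric], rule bij_betw_nth) (use xs in auto)
  also have "\<dots> \<le> ennreal (Beta p 2) * (\<Sum>\<^sub>\<infinity>n. ennreal (bond_potential a b n powr (p + 1)))"
  proof (rule ordered_system_bound[where U = "\<lambda>k. U (xs ! k)"])
    show "E (xs ! k) \<le> E (xs ! j)" if "j \<le> k" "k < length xs" for j k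
      using sorted_nth_mono[OF xs(3) that(1)] that by simp
    show "ell2_ip (U (xs ! j)) (U (xs ! k)) = (if j = k then 1 else 0)"
      if "j < length xs" "k < length xs" for j k
      using ortho[OF mem[OF that(1)] mem[OF that(2)]] nth_eq_iff_index_eq[OF xs(1) that] by simp
  qed (use a p E U mem in auto)
  finally show ?thesis .
qed

section \<open>Orthonormal systems of eigenvectors\<close>

lemma subspace_ell2: "seq.subspace ell2"
proof (rule seq.subspaceI)
  show "0 \<in> ell2" by (simp add: ell2_def)
next
  fix u v :: "int \<Rightarrow> complex" assume "u \<in> ell2" "v \<in> ell2"
  then have "(\<lambda>n. 2 * (cmod (u n))\<^sup>2 + 2 * (cmod (v n))\<^sup>2) summable_on UNIV"
    unfolding ell2_def by (intro summable_on_add summable_on_cmult_right) auto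
  moreover have "(cmod ((u + v) n))\<^sup>2 \<le> 2 * (cmod (u n))\<^sup>2 + 2 * (cmod (v n))\<^sup>2" for n
  proof -
    have "(cmod ((u + v) n))\<^sup>2 \<le> (cmod (u n) + cmod (v n))\<^sup>2"
      by (intro power_mono) (auto simp: norm_triangle_ineq)
    also have "\<dots> \<le> 2 * (cmod (u n))\<^sup>2 + 2 * (cmod (v n))\<^sup>2"
      using sum_squares_bound[of "cmod (u n)" "cmod (v n)"] by (simp add: power2_sum)
    finally show ?thesis .
  qed
  ultimately show "u + v \<in> ell2"
    unfolding ell2_def by (auto intro: summable_on_comparison_test)
next
  fix c and u :: "int \<Rightarrow> complex" assume "u \<in> ell2"
  then show "seq_scale c u \<in> ell2"
    unfolding ell2_def seq_scale_def
    by (auto simp: norm_mult power_mult_distrib intro!: summable_on_cmult_right)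
qed

lemma subspace_eigenspace: "seq.subspace (eigenspace (jacobi a b) E)"
proof -
  have *: "jacobi a b 0 = 0" "jacobi a b (u + v) = jacobi a b u + jacobi a b v"
    "jacobi a b (seq_scale c u) = seq_scale c (jacobi a b u)" for u v c
    by (auto simp: jacobi_def seq_scale_def fun_eq_iff algebra_simps)
  have "seq.subspace {u. jacobi a b u = seq_scale (of_real E) u}"
    by (rule seq.subspaceI)
      (auto simp: * seq.scale_right_distrib seq.scale_left_commute)
  then have "seq.subspace (ell2 \<inter> {u. jacobi a b u = seq_scale (of_real E) u})"
    by (intro seq.subspace_inter subspace_ell2)
  moreover have "eigenspace (jacobi a b) E = ell2 \<inter> {u. jacobi a b u = seq_scale (of_real E) u}"
    by (auto simp: eigenspace_def)
  ultimately show ?thesis by simp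
qed

lemma ell2_ip_add_right:
  assumes "u \<in> ell2" "v \<in> ell2" "w \<in> ell2"
  shows "ell2_ip u (v + w) = ell2_ip u v + ell2_ip u w"
  using infsum_add[OF ell2_ip_summable[OF assms(1,2)] ell2_ip_summable[OF assms(1,3)]]
  unfolding ell2_ip_def by (simp add: distrib_left)

lemma ell2_ip_scale_right: "ell2_ip u (seq_scale c v) = c * ell2_ip u v"
  unfolding ell2_ip_def seq_scale_def infsum_cmult_right'[symmetric] by (simp add: mult_ac)

lemma ell2_ip_scale_left: "ell2_ip (seq_scale c u) v = cnj c * ell2_ip u v"
  by (subst (1 2) ell2_ip_cnj) (simp add: ell2_ip_scale_right)

lemma ell2_ip_sum_right:
  assumes "u \<in> ell2" "\<And>p. p \<in> S \<Longrightarrow> v p \<in> ell2"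
  shows "ell2_ip u (\<Sum>p\<in>S. v p) = (\<Sum>p\<in>S. ell2_ip u (v p))"
  using assms(2)
proof (induction S rule: infinite_finite_induct)
  case (insert p S)
  then have "(\<Sum>p\<in>S. v p) \<in> ell2" by (intro seq.subspace_sum[OF subspace_ell2]) auto
  then have add: "ell2_ip u (v p + (\<Sum>p\<in>S. v p)) = ell2_ip u (v p) + ell2_ip u (\<Sum>p\<in>S. v p)"
    using insert.prems assms(1) by (intro ell2_ip_add_right) auto
  have "ell2_ip u (\<Sum>p\<in>S. v p) = (\<Sum>p\<in>S. ell2_ip u (v p))"
    by (rule insert.IH) (use insert.prems in auto)
  then show ?case unfolding sum.insert[OF insert.hyps] add by simp
qed (auto simp: ell2_ip_def)

lemma ell2_ip_self:
  assumes "u \<in> ell2" "u \<noteq> 0"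
  shows "\<exists>S>0. ell2_ip u u = of_real S"
proof -
  define S where "S = (\<Sum>\<^sub>\<infinity>n. (cmod (u n))\<^sup>2)"
  have sum: "((\<lambda>n. (cmod (u n))\<^sup>2) has_sum S) UNIV"
    using assms(1) unfolding ell2_def S_def by simp
  have "ell2_ip u u = (\<Sum>\<^sub>\<infinity>n. of_real ((cmod (u n))\<^sup>2))"
    unfolding ell2_ip_def complex_norm_square by (simp add: mult.commute)
  also have "\<dots> = of_real S"
    by (rule infsumI, rule has_sum_of_real[OF sum])
  finally have "ell2_ip u u = of_real S" .
  moreover obtain n where n: "u n \<noteq> 0" using assms(2) by (auto simp: fun_eq_iff)
  have "(cmod (u n))\<^sup>2 \<le> S"
    using finite_sum_le_has_sum[OF sum, of "{n}"] by simp
  then have "S > 0" using n by (smt (verit) zero_less_norm_iff zero_less_power)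
  ultimately show ?thesis by blast
qed

text \<open>Finite and infinite multiplicity are treated alike: a finite spanning set would turn
  \<open>eigen_mult\<close> into a dimension of at most \<open>m\<close>.\<close>

lemma eigenspace_not_spanned:
  assumes "enat (Suc m) \<le> eigen_mult T E" "finite B" "card B \<le> m"
  shows "\<exists>v\<in>eigenspace T E. v \<notin> seq_span B"
proof (rule ccontr)
  assume "\<not> ?thesis"
  then have sub: "eigenspace T E \<subseteq> seq_span B" by auto
  then have "eigen_mult T E = enat (seq_dim (eigenspace T E))"
    using assms(2) unfolding eigen_mult_def by auto
  moreover have "seq_dim (eigenspace T E) \<le> card B"
    by (rule seq.dim_le_card[OF sub assms(2)])
  ultimately show False using assms by simp
qed

lemma orthonormal_eigenvectors:
  assumes "enat m \<le> eigen_mult (jacobi a b) E"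
  shows "\<exists>\<phi>. (\<forall>p<m. \<phi> p \<in> eigenspace (jacobi a b) E) \<and>
    (\<forall>p<m. \<forall>q<m. ell2_ip (\<phi> p) (\<phi> q) = (if p = q then 1 else 0))"
  using assms
proof (induction m)
  case 0
  then show ?case by simp
next
  case (Suc m)
  have "enat m \<le> eigen_mult (jacobi a b) E" by (rule order_trans[OF _ Suc.prems]) simp
  from Suc.IH[OF this] obtain \<phi> where \<phi>: "\<And>p. p < m \<Longrightarrow> \<phi> p \<in> eigenspace (jacobi a b) E"
    "\<And>p q. p < m \<Longrightarrow> q < m \<Longrightarrow> ell2_ip (\<phi> p) (\<phi> q) = (if p = q then 1 else 0)"
    by blast
  have \<phi>_ell2: "\<phi> p \<in> ell2" if "p < m" for p using \<phi>(1)[OF that] by (simp add: eigenspace_def)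
  obtain v where v: "v \<in> eigenspace (jacobi a b) E" "v \<notin> seq_span (\<phi> ` {..<m})"
    using eigenspace_not_spanned[OF Suc.prems, of "\<phi> ` {..<m}"] card_image_le[of "{..<m}" \<phi>] by auto
  \<comment> \<open>Gram-Schmidt: \<open>w\<close> is \<open>v\<close> minus its projection onto the
    vectors found so far, and it is nonzero since \<open>v\<close> lies outside their span.\<close>
  define w where "w = v + (\<Sum>p<m. seq_scale (- ell2_ip (\<phi> p) v) (\<phi> p))"
  have v_ell2: "v \<in> ell2" using v(1) by (simp add: eigenspace_def)
  have w: "w \<in> eigenspace (jacobi a b) E"
    unfolding w_def by (intro seq.subspace_add[OF subspace_eigenspace] seq.subspace_sum[OF subspace_eigenspace]
        seq.subspace_scale[OF subspace_eigenspace] v(1) \<phi>(1)) auto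
  then have w_ell2: "w \<in> ell2" by (simp add: eigenspace_def)
  have "w \<noteq> 0"
  proof
    assume "w = 0"
    then have "v = - (\<Sum>p<m. seq_scale (- ell2_ip (\<phi> p) v) (\<phi> p))"
      unfolding w_def by (simp add: eq_neg_iff_add_eq_0)
    moreover have "- (\<Sum>p<m. seq_scale (- ell2_ip (\<phi> p) v) (\<phi> p)) \<in> seq_span (\<phi> ` {..<m})"
      by (intro seq.span_neg seq.span_sum seq.span_scale seq.span_base) auto
    ultimately show False using v(2) by simp
  qed
  then obtain S where S: "S > 0" "ell2_ip w w = of_real S" using ell2_ip_self[OF w_ell2] by auto
  have ortho: "ell2_ip (\<phi> q) w = 0" if q: "q < m" for q
  proof -
    have scaled: "seq_scale (- ell2_ip (\<phi> p) v) (\<phi> p) \<in> ell2" if "p < m" for p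
      by (rule seq.subspace_scale[OF subspace_ell2 \<phi>_ell2[OF that]])
    have "ell2_ip (\<phi> q) w = ell2_ip (\<phi> q) v + ell2_ip (\<phi> q) (\<Sum>p<m. seq_scale (- ell2_ip (\<phi> p) v) (\<phi> p))"
      unfolding w_def using scaled
      by (intro ell2_ip_add_right \<phi>_ell2 q v_ell2 seq.subspace_sum[OF subspace_ell2]) auto
    also have "ell2_ip (\<phi> q) (\<Sum>p<m. seq_scale (- ell2_ip (\<phi> p) v) (\<phi> p))
        = (\<Sum>p<m. ell2_ip (\<phi> q) (seq_scale (- ell2_ip (\<phi> p) v) (\<phi> p)))"
      using scaled by (intro ell2_ip_sum_right \<phi>_ell2 q) auto
    also have "\<dots> = (\<Sum>p<m. - ell2_ip (\<phi> p) v * ell2_ip (\<phi> q) (\<phi> p))"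
      unfolding ell2_ip_scale_right ..
    also have "(\<Sum>p<m. - ell2_ip (\<phi> p) v * ell2_ip (\<phi> q) (\<phi> p)) = (\<Sum>p<m. if p = q then - ell2_ip (\<phi> q) v else 0)"
      using \<phi>(2) q by (intro sum.cong) auto
    also have "\<dots> = - ell2_ip (\<phi> q) v" using q by simp
    finally show ?thesis by simp
  qed
  define e where "e = seq_scale (of_real (1 / sqrt S)) w"
  have e: "e \<in> eigenspace (jacobi a b) E"
    unfolding e_def using w by (rule seq.subspace_scale[OF subspace_eigenspace])
  have "ell2_ip e e = of_real (1 / sqrt S) * (of_real (1 / sqrt S) * of_real S)"
    unfolding e_def ell2_ip_scale_left ell2_ip_scale_right S(2) by simp
  also have "\<dots> = of_real (1 / sqrt S * (1 / sqrt S * S))" by (simp only: of_real_mult)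
  also have "1 / sqrt S * (1 / sqrt S * S) = 1" using S(1) by (simp add: real_div_sqrt)
  finally have ee: "ell2_ip e e = 1" by simp
  have \<phi>e: "ell2_ip (\<phi> q) e = 0" if "q < m" for q
    unfolding e_def ell2_ip_scale_right ortho[OF that] by simp
  then have e\<phi>: "ell2_ip e (\<phi> q) = 0" if "q < m" for q
    using that ell2_ip_cnj[of e "\<phi> q"] by simp
  show ?case
    using \<phi> e ee \<phi>e e\<phi> by (intro exI[of _ "\<phi>(m := e)"]) (auto simp: less_Suc_eq)
qed

lemma eigen_system_exists:
  assumes a: "(a \<longlongrightarrow> 1) at_top" "(a \<longlongrightarrow> 1) at_bot"
    and F: "finite F" "F \<subseteq> eigenvalues_rep (jacobi a b)"
  shows "\<exists>U. (\<forall>x\<in>F. U x \<in> ell2 \<and> jacobi a b (U x) = seq_scale (of_real (fst x)) (U x)) \<and>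
    (\<forall>x\<in>F. \<forall>y\<in>F. ell2_ip (U x) (U y) = (if x = y then 1 else 0))"
proof -
  have "\<exists>\<phi>. \<forall>k l. (E, k) \<in> F \<longrightarrow> (E, l) \<in> F \<longrightarrow> \<phi> k \<in> eigenspace (jacobi a b) E \<and>
      ell2_ip (\<phi> k) (\<phi> l) = (if k = l then 1 else 0)" for E
  proof (cases "\<exists>k. (E, k) \<in> F")
    case True
    \<comment> \<open>\<open>F\<close> may contain some copies \<open>(E, k)\<close> of an
      eigenvalue and omit others, so the orthonormal system is built up to the largest index that
      occurs.\<close>
    define P where "P = {k. (E, k) \<in> F}"
    have "P \<subseteq> snd ` F" unfolding P_def by force
    then have P: "finite P" "P \<noteq> {}" using F(1) True finite_subset unfolding P_def by auto
    then have "Max P \<in> P" by simp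
    then have "enat (Suc (Max P)) \<le> eigen_mult (jacobi a b) E"
      using F(2) unfolding P_def eigenvalues_rep_def by (auto simp: Suc_ile_eq)
    then obtain \<phi> where "\<forall>p<Suc (Max P). \<phi> p \<in> eigenspace (jacobi a b) E"
      "\<forall>p<Suc (Max P). \<forall>q<Suc (Max P). ell2_ip (\<phi> p) (\<phi> q) = (if p = q then 1 else 0)"
      using orthonormal_eigenvectors by blast
    moreover have "k < Suc (Max P)" if "(E, k) \<in> F" for k
      using Max_ge[OF P(1), of k] that by (simp add: P_def)
    ultimately show ?thesis by (intro exI[of _ \<phi>]) auto
  qed auto
  then obtain \<phi> where \<phi>: "\<And>E k l. (E, k) \<in> F \<Longrightarrow> (E, l) \<in> F \<Longrightarrow> \<phi> E k \<in> eigenspace (jacobi a b) E \<and>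
      ell2_ip (\<phi> E k) (\<phi> E l) = (if k = l then 1 else 0)"
    by metis
  define U where "U x = \<phi> (fst x) (snd x)" for x
  have U: "U x \<in> ell2" "jacobi a b (U x) = seq_scale (of_real (fst x)) (U x)" if "x \<in> F" for x
    using \<phi>[of "fst x" "snd x" "snd x"] that by (auto simp: U_def eigenspace_def)
  have "ell2_ip (U x) (U y) = (if x = y then 1 else 0)" if "x \<in> F" "y \<in> F" for x y
  proof (cases "fst x = fst y")
    case True
    have "(fst y, snd x) \<in> F" using that(1) by (simp flip: True)
    moreover have "(fst y, snd y) \<in> F" using that(2) by simp
    ultimately show ?thesis using \<phi> by (simp add: U_def True prod_eq_iff)
  next
    case False
    then show ?thesis
      using eigenvectors_orthogonal[OF a U[OF that(1)] U[OF that(2)]] by auto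
  qed
  then show ?thesis using U by blast
qed

lemma eigen_system_bound_neg:
  fixes E :: "'i \<Rightarrow> real"
  assumes a: "(a \<longlongrightarrow> 1) at_top" "(a \<longlongrightarrow> 1) at_bot" "\<And>i. 0 \<le> a i" and p: "p > 0"
    and F: "finite F" and E: "\<And>x. x \<in> F \<Longrightarrow> E x < - 2"
    and U: "\<And>x. x \<in> F \<Longrightarrow> U x \<in> ell2" "\<And>x. x \<in> F \<Longrightarrow> jacobi a b (U x) = seq_scale (of_real (E x)) (U x)"
    and ortho: "\<And>x y. x \<in> F \<Longrightarrow> y \<in> F \<Longrightarrow> ell2_ip (U x) (U y) = (if x = y then 1 else 0)"
  shows "(\<Sum>x\<in>F. \<integral>\<^sup>+t\<in>{2..- E x}. ennreal ((t\<^sup>2 - 4) powr (1/2) * (- E x - t) powr (p - 1)) \<partial>lborel)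
    \<le> ennreal (Beta p 2) * (\<Sum>\<^sub>\<infinity>n. ennreal (bond_potential a (\<lambda>n. - b n) n powr (p + 1)))"
proof -
  \<comment> \<open>Neighbouring signs differ, so the bond terms change sign, and with the diagonal
    \<open>- b\<close> so does the whole matrix. Inner products are preserved because \<sigma> has
    modulus 1.\<close>
  define \<sigma> :: "int \<Rightarrow> complex" where "\<sigma> i = (if even i then 1 else - 1)" for i
  have \<sigma>: "cmod (\<sigma> i) = 1" "\<sigma> (i - 1) = - \<sigma> i" "\<sigma> (i + 1) = - \<sigma> i" for i
    by (auto simp: \<sigma>_def)
  show ?thesis
  proof (rule eigen_system_bound[where E = "\<lambda>x. - E x" and U = "\<lambda>x i. \<sigma> i * U x i"])
    show "2 < - E x" if "x \<in> F" for x using E[OF that] by simp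
    show "(\<lambda>i. \<sigma> i * U x i) \<in> ell2" if "x \<in> F" for x
      using U(1)[OF that] by (simp add: ell2_def norm_mult \<sigma>)
    show "jacobi a (\<lambda>n. - b n) (\<lambda>i. \<sigma> i * U x i) = seq_scale (of_real (- E x)) (\<lambda>i. \<sigma> i * U x i)"
      if "x \<in> F" for x
    proof
      fix i
      have "jacobi a (\<lambda>n. - b n) (\<lambda>i. \<sigma> i * U x i) i = - \<sigma> i * jacobi a b (U x) i"
        unfolding jacobi_def \<sigma> by (simp add: algebra_simps)
      then show "jacobi a (\<lambda>n. - b n) (\<lambda>i. \<sigma> i * U x i) i = seq_scale (of_real (- E x)) (\<lambda>i. \<sigma> i * U x i) i"
        unfolding U(2)[OF that] by (simp add: seq_scale_def)
    qed
    show "ell2_ip (\<lambda>i. \<sigma> i * U x i) (\<lambda>i. \<sigma> i * U y i) = (if x = y then 1 else 0)"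
      if "x \<in> F" "y \<in> F" for x y
    proof -
      have "cnj (\<sigma> i * U x i) * (\<sigma> i * U y i) = cnj (U x i) * U y i" for i
        by (simp add: \<sigma>_def)
      then have "ell2_ip (\<lambda>i. \<sigma> i * U x i) (\<lambda>i. \<sigma> i * U y i) = ell2_ip (U x) (U y)"
        unfolding ell2_ip_def by (simp only:)
      then show ?thesis using ortho[OF that] by simp
    qed
  qed (use a p F in auto)
qed

section \<open>Passage from finite sets of eigenvalues to all, for both signs\<close>

theorem mainTheorem2:
  fixes \<gamma> :: real and a b :: "int \<Rightarrow> real"
  assumes "\<gamma> > 1/2"
    and "(\<lambda>n. \<bar>b n\<bar> powr (\<gamma> + 1/2)) summable_on UNIV"
    and "\<And>n. a n \<ge> 0"
    and "(a \<longlongrightarrow> 1) at_top" and "(a \<longlongrightarrow> 1) at_bot"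
    and "(\<lambda>n. pos_part (a n - 1) powr (\<gamma> + 1/2)) summable_on UNIV"
  shows
    "(\<Sum>\<^sub>\<infinity>(E, k)\<in>{(E, k) \<in> eigenvalues_rep (jacobi a b). E > 2}.
        \<integral>\<^sup>+t\<in>{2..\<bar>E\<bar>}. ennreal ((t\<^sup>2 - 4) powr (1/2) * (\<bar>E\<bar> - t) powr (\<gamma> - 3/2)) \<partial>lborel)
      \<le> ennreal (Beta (\<gamma> - 1/2) 2) *
        (\<Sum>\<^sub>\<infinity>n\<in>UNIV. ennreal
           (pos_part (pos_part (b n) + pos_part (a n - 1) + pos_part (a (n - 1) - 1))
              powr (\<gamma> + 1/2)))
     \<and>
     (\<Sum>\<^sub>\<infinity>(E, k)\<in>{(E, k) \<in> eigenvalues_rep (jacobi a b). E < - 2}.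
        \<integral>\<^sup>+t\<in>{2..\<bar>E\<bar>}. ennreal ((t\<^sup>2 - 4) powr (1/2) * (\<bar>E\<bar> - t) powr (\<gamma> - 3/2)) \<partial>lborel)
      \<le> ennreal (Beta (\<gamma> - 1/2) 2) *
        (\<Sum>\<^sub>\<infinity>n\<in>UNIV. ennreal
           (neg_part (- neg_part (b n) - pos_part (a n - 1) - pos_part (a (n - 1) - 1))
              powr (\<gamma> + 1/2)))"
proof
  have p: "\<gamma> - 1/2 > 0" and p1: "\<gamma> - 1/2 - 1 = \<gamma> - 3/2" and p2: "\<gamma> - 1/2 + 1 = \<gamma> + 1/2"
    using assms(1) by auto
  show "(\<Sum>\<^sub>\<infinity>(E, k)\<in>{(E, k) \<in> eigenvalues_rep (jacobi a b). E > 2}.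
        \<integral>\<^sup>+t\<in>{2..\<bar>E\<bar>}. ennreal ((t\<^sup>2 - 4) powr (1/2) * (\<bar>E\<bar> - t) powr (\<gamma> - 3/2)) \<partial>lborel)
      \<le> ennreal (Beta (\<gamma> - 1/2) 2) *
        (\<Sum>\<^sub>\<infinity>n\<in>UNIV. ennreal
           (pos_part (pos_part (b n) + pos_part (a n - 1) + pos_part (a (n - 1) - 1))
              powr (\<gamma> + 1/2)))"
  \<comment> \<open>In the extended nonnegative reals it suffices to bound the sum over every finite
    set of eigenvalues, counted with multiplicity.\<close>
  proof (rule infsum_le_finite_sums)
    fix F assume F: "finite F" "F \<subseteq> {(E, k) \<in> eigenvalues_rep (jacobi a b). E > 2}"
    then have "F \<subseteq> eigenvalues_rep (jacobi a b)" by auto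
    from eigen_system_exists[OF assms(4,5) F(1) this] obtain U where
      U: "\<And>x. x \<in> F \<Longrightarrow> U x \<in> ell2" "\<And>x. x \<in> F \<Longrightarrow> jacobi a b (U x) = seq_scale (of_real (fst x)) (U x)"
        "\<And>x y. x \<in> F \<Longrightarrow> y \<in> F \<Longrightarrow> ell2_ip (U x) (U y) = (if x = y then 1 else 0)" by blast
    have E: "fst x > 2" if "x \<in> F" for x using F(2) that by auto
    have "(\<Sum>(E, k)\<in>F. \<integral>\<^sup>+t\<in>{2..\<bar>E\<bar>}. ennreal ((t\<^sup>2 - 4) powr (1/2) * (\<bar>E\<bar> - t) powr (\<gamma> - 3/2)) \<partial>lborel)
      = (\<Sum>x\<in>F. \<integral>\<^sup>+t\<in>{2..fst x}. ennreal ((t\<^sup>2 - 4) powr (1/2) * (fst x - t) powr (\<gamma> - 1/2 - 1)) \<partial>lborel)"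
      unfolding p1 by (intro sum.cong refl) (use E in \<open>force simp: case_prod_beta\<close>)
    also have "\<dots> \<le> ennreal (Beta (\<gamma> - 1/2) 2)
        * (\<Sum>\<^sub>\<infinity>n. ennreal (bond_potential a b n powr (\<gamma> - 1/2 + 1)))"
      by (rule eigen_system_bound[OF assms(4,5,3) p F(1) E U])
    also have "bond_potential a b = (\<lambda>n. pos_part (pos_part (b n) + pos_part (a n - 1) + pos_part (a (n - 1) - 1)))"
      by (auto simp: bond_potential_def pos_part_def fun_eq_iff)
    finally show "(\<Sum>(E, k)\<in>F. \<integral>\<^sup>+t\<in>{2..\<bar>E\<bar>}. ennreal ((t\<^sup>2 - 4) powr (1/2) * (\<bar>E\<bar> - t) powr (\<gamma> - 3/2)) \<partial>lborel)
      \<le> ennreal (Beta (\<gamma> - 1/2) 2) *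
        (\<Sum>\<^sub>\<infinity>n\<in>UNIV. ennreal
           (pos_part (pos_part (b n) + pos_part (a n - 1) + pos_part (a (n - 1) - 1))
              powr (\<gamma> + 1/2)))" unfolding p2 .
  qed (auto intro: nonneg_summable_on_complete)
  show "(\<Sum>\<^sub>\<infinity>(E, k)\<in>{(E, k) \<in> eigenvalues_rep (jacobi a b). E < - 2}.
        \<integral>\<^sup>+t\<in>{2..\<bar>E\<bar>}. ennreal ((t\<^sup>2 - 4) powr (1/2) * (\<bar>E\<bar> - t) powr (\<gamma> - 3/2)) \<partial>lborel)
      \<le> ennreal (Beta (\<gamma> - 1/2) 2) *
        (\<Sum>\<^sub>\<infinity>n\<in>UNIV. ennreal
           (neg_part (- neg_part (b n) - pos_part (a n - 1) - pos_part (a (n - 1) - 1))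
              powr (\<gamma> + 1/2)))"
  proof (rule infsum_le_finite_sums)
    fix F assume F: "finite F" "F \<subseteq> {(E, k) \<in> eigenvalues_rep (jacobi a b). E < - 2}"
    then have "F \<subseteq> eigenvalues_rep (jacobi a b)" by auto
    from eigen_system_exists[OF assms(4,5) F(1) this] obtain U where
      U: "\<And>x. x \<in> F \<Longrightarrow> U x \<in> ell2" "\<And>x. x \<in> F \<Longrightarrow> jacobi a b (U x) = seq_scale (of_real (fst x)) (U x)"
        "\<And>x y. x \<in> F \<Longrightarrow> y \<in> F \<Longrightarrow> ell2_ip (U x) (U y) = (if x = y then 1 else 0)" by blast
    have E: "fst x < - 2" if "x \<in> F" for x using F(2) that by auto
    have "(\<Sum>(E, k)\<in>F. \<integral>\<^sup>+t\<in>{2..\<bar>E\<bar>}. ennreal ((t\<^sup>2 - 4) powr (1/2) * (\<bar>E\<bar> - t) powr (\<gamma> - 3/2)) \<partial>lborel)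
      = (\<Sum>x\<in>F. \<integral>\<^sup>+t\<in>{2..- fst x}. ennreal ((t\<^sup>2 - 4) powr (1/2) * (- fst x - t) powr (\<gamma> - 1/2 - 1)) \<partial>lborel)"
      unfolding p1 by (intro sum.cong refl) (use E in \<open>force simp: case_prod_beta\<close>)
    also have "\<dots> \<le> ennreal (Beta (\<gamma> - 1/2) 2)
        * (\<Sum>\<^sub>\<infinity>n. ennreal (bond_potential a (\<lambda>n. - b n) n powr (\<gamma> - 1/2 + 1)))"
      by (rule eigen_system_bound_neg[OF assms(4,5,3) p F(1) E U])
    \<comment> \<open>The positive part of \<open>- b n\<close> is the negative part of
      \<open>b n\<close>, and the outer negative part reverses all signs.\<close>
    also have "bond_potential a (\<lambda>n. - b n)
        = (\<lambda>n. neg_part (- neg_part (b n) - pos_part (a n - 1) - pos_part (a (n - 1) - 1)))"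
      by (auto simp: bond_potential_def pos_part_def neg_part_def fun_eq_iff)
    finally show "(\<Sum>(E, k)\<in>F. \<integral>\<^sup>+t\<in>{2..\<bar>E\<bar>}. ennreal ((t\<^sup>2 - 4) powr (1/2) * (\<bar>E\<bar> - t) powr (\<gamma> - 3/2)) \<partial>lborel)
      \<le> ennreal (Beta (\<gamma> - 1/2) 2) *
        (\<Sum>\<^sub>\<infinity>n\<in>UNIV. ennreal
           (neg_part (- neg_part (b n) - pos_part (a n - 1) - pos_part (a (n - 1) - 1))
              powr (\<gamma> + 1/2)))" unfolding p2 .
  qed (auto intro: nonneg_summable_on_complete)
qed

end
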